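(* Consider the hybrid system $\mathcal{H}_v^0$ with state $\vartheta=(x,u,\tau_{v,1},\tau_{v,2},\sigma_v,w)$ defined in the context, and let Assumptions (A1)–(A7) of the context hold. Let $\tilde\beta>0$, $\omega:=\max\left\{\bar\lambda(P)/\tilde\beta,\ \tilde\beta/\underline\lambda(P)\right\}$, and suppose that $\kappa_{v,1}>0$, $\kappa_{v,2}\in(0,1)$ satisfy $$\underline\lambda(R)>\bar\lambda(P)\ln(\omega)\kappa_{v,1}+\kappa_{v,2}\left(\underline\lambda(R)+\bar\lambda(P)\bar\lambda(\hat R_a)\right).$$ Put $\rho:=\frac{\underline\lambda(R)}{\bar\lambda(P)}-\kappa_{v,2}\left(\frac{\underline\lambda(R)}{\bar\lambda(P)}+\bar\lambda(\hat R_a)\right)-\ln(\omega)\kappa_{v,1}>0$ and $\tau_0:=\ln(\omega)N_{0,v}+T_{0,v}\left(\frac{\underline\lambda(R)}{\bar\lambda(P)}+\bar\lambda(\hat R_a)\right)$, and suppose $$0<\varepsilon<\varepsilon^*:=\frac{\rho\min\{\underline\lambda(P),\tilde\beta\}\mu^2}{2\ell_ye^{\tau_0}\|C\|\|G\|\|A^{-1}B\|\max\{\bar\lambda(P),\tilde\beta\}(\mu^2+\ell^2)}.$$ Then the set $$\mathcal{A}^*=\{(x,u,\tau_{v,1},\tau_{v,2},\sigma_v,w):\ x=x^*(u^*_w,w),\ u=u^*_w,\ \tau_{v,1}\in[0,N_{0,v}],\ \tau_{v,2}\in[0,T_{0,v}],\ \sigma_v\in\Sigma_v,\ w\in\mathcal{W}\}$$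 is uniformly globally exponentially stable (UGES) for $\mathcal{H}_v^0$.
   Context: Norms: $\|\cdot\|$ is the Euclidean norm of vectors and the largest singular value of matrices; $\bar\lambda,\underline\lambda$ are the largest and smallest eigenvalues of a symmetric matrix. For compact $\mathcal{A}$, $|z|_{\mathcal{A}}=\min_{s\in\mathcal{A}}\|z-s\|$. $I_O$ is the indicator function of the set $O$ (value $1$ on $O$, $0$ off $O$). Hybrid systems: a hybrid system is given by a flow set $\mathcal{C}$, set-valued flow map $F$, jump set $\mathcal{D}$ and set-valued jump map $\mathcal{G}$: $p\in\mathcal{C},\ \dot p\in F(p)$; $p\in\mathcal{D},\ p^+\in\mathcal{G}(p)$. A compact hybrid time domain is a set $\bigcup_{j=0}^{J-1}([t_j,t_{j+1}]\times\{j\})$ with $0=t_0\le t_1\le\dots\le t_J$; a hybrid time domain is a set $E\subset\mathbb{R}_{\ge0}\times\mathbb{Z}_{\ge0}$ such that $E\cap([0,T]\times\{0,\dots,J\})$ is a compact hybrid time domain for every $(T,J)\in E$. A solution is a function $p$ on a hybrid time domain $\mathrm{dom}(p)$ with $p(0,0)\in\overline{\mathcal{C}}\cup\mathcal{D}$ such that, for each $j$ for which $I_j=\{t:(t,j)\in\mathrm{dom}(p)\}$ has nonempty interior, $t\mapsto p(t,j)$ is locally absolutely continuous, $p(t,j)\in\mathcal{C}$ for $t\in\mathrm{int}(I_j)$ and $\dot p(t,j)\in F(p(t,j))$ for almost all $t\in I_j$; and whenever $(t,j),(t,j+1)\in\mathrm{dom}(p)$, $p(t,j)\in\mathcal{D}$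 and $p(t,j+1)\in\mathcal{G}(p(t,j))$. A compact set $\mathcal{A}\subset\mathcal{C}\cup\mathcal{D}$ is UGES if there are $c_1,c_2>0$ such that every solution satisfies $|p(t,j)|_{\mathcal{A}}\le c_1|p(0,0)|_{\mathcal{A}}e^{-c_2(t+j)}$ for all $(t,j)\in\mathrm{dom}(p)$. Data: matrices $F\in\mathbb{R}^{n\times n}$, $N\in\mathbb{R}^{n\times m_v}$, $B\in\mathbb{R}^{n\times m}$, $E\in\mathbb{R}^{n\times q}$, $C\in\mathbb{R}^{p\times n}$, $K\in\mathbb{R}^{m_v\times p}$; $A:=F+NKC$, $G:=-CA^{-1}B$, $H:=-CA^{-1}E$; costs $f_u:\mathbb{R}^m\to\mathbb{R}$, $f_y:\mathbb{R}^p\to\mathbb{R}$; $f(u,w):=f_u(u)+f_y(Gu+Hw)$. $\Sigma_{v,a}$ and $\Sigma_{u,a}$ are index sets of attack modes (subsets of the positive integers), with attack matrices $L_\sigma\in\mathbb{R}^{m_v\times m_v}$, $L^b_\sigma,L^e_\sigma\in\mathbb{R}^{n\times n}$ ($\sigma\in\Sigma_{v,a}$) and $M_\sigma\in\mathbb{R}^{m\times m}$ ($\sigma\in\Sigma_{u,a}$). A further index $s$ denotes the nominal mode, for which all these matrices are identities; $\Sigma_v=\{s\}\cup\Sigma_{v,a}$, $\Sigma_u=\{s\}\cup\Sigma_{u,a}$. For $\sigma\in\Sigma_v$: $A_\sigma:=F+NL_\sigma KC$, $B_\sigma:=L^b_\sigma B$, $E_\sigma:=L^e_\sigma E$ (so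 $A_s=A$, $B_s=B$, $E_s=E$). Assumptions: (A1) $w$ is generated by $\dot w=\Pi(w)$, $w(0)\in\mathcal{W}$, with $\Pi$ Lipschitz continuous and $\mathcal{W}\subset\mathbb{R}^q$ compact, contained in the ball of radius $\bar w$, and forward invariant. (In this statement $\Pi$ is replaced by $0$.) (A2) For every positive definite $R\in\mathbb{R}^{n\times n}$ there is a unique positive definite $P$ with $A^\top P+PA=-R$. (Such a pair $(R,P)$ is fixed.) (A3) $f_u,f_y$ are continuously differentiable and their gradients are globally Lipschitz with constants $\ell_u,\ell_y>0$. Set $\ell:=\ell_u+\ell_y\|G\|^2$. (A4) For each $w$, $u\mapsto f(u,w)$ has a unique (bounded) minimizer $u^*_w$, and there is $\mu>0$ with $\frac12\|\nabla_uf(u,w)\|^2\ge\mu(f(u,w)-f(u^*_w,w))$ for all $u\in\mathbb{R}^m$, $w\in\mathcal{W}$. (A5) $u^*_w=h(w)$ for $w\in\mathcal{W}$, with $h$ continuously differentiable. (A6) $\Sigma_v,\Sigma_u$ are finite; (i) for all $\sigma\in\Sigma_{v,a}$, $A_\sigma$ is invertible and has at least one eigenvalue with positive real part; (ii) for all $\sigma\in\Sigma_{u,a}$, $M_\sigma$ has at least one eigenvalue with negative real part. (A7) For any $w\in\mathcal{W}$ and $\bar u\in\mathbb{R}^m$ there exists a unique $\bar x\in\mathbb{R}^n$ such that $0=A_\sigma\bar x+B_\sigma\bar u+E_\sigma w$ for all $\sigma\in\Sigma_v$. Notation: $\hat R_{\sigma}:=A_\sigma^\top+A_\sigma$ and $\bar\lambda(\hat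 R_a):=\max_{\sigma\in\Sigma_{v,a}}\bar\lambda(\hat R_\sigma)$. The common equilibrium is $x^*(u,w):=-A_\sigma^{-1}B_\sigma u-A_\sigma^{-1}E_\sigma w$, which by (A7) does not depend on $\sigma\in\Sigma_v$. Hybrid system $\mathcal{H}_v^0$ (attacks on the static feedback, constant $w$), with $N_{0,v}\in\mathbb{Z}_{\ge1}$, $T_{0,v}\ge0$, $\varepsilon>0$: flow set $\mathcal{C}=\mathbb{R}^n\times\mathbb{R}^m\times[0,N_{0,v}]\times[0,T_{0,v}]\times\Sigma_v\times\mathcal{W}$; flows $\dot x=A_{\sigma_v}x+B_{\sigma_v}u+E_{\sigma_v}w$, $\dot u=-\varepsilon(\nabla f_u(u)+G^\top\nabla f_y(Cx))$, $\dot\tau_{v,1}\in[0,\kappa_{v,1}]$, $\dot\tau_{v,2}\in[0,\kappa_{v,2}]-I_{\Sigma_{v,a}}(\sigma_v)$, $\dot\sigma_v=0$, $\dot w=0$; jump set $\mathcal{D}=\mathbb{R}^n\times\mathbb{R}^m\times[1,N_{0,v}]\times[0,T_{0,v}]\times\Sigma_v\times\mathcal{W}$; jumps $x^+=x$, $u^+=u$, $\tau_{v,1}^+=\tau_{v,1}-1$, $\tau_{v,2}^+=\tau_{v,2}$, $\sigma_v^+\in\Sigma_v\setminus\{\sigma_v\}$, $w^+=w$. *)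

theory Defs
  imports "HOL-Analysis.Analysis"
begin

section \<open>Matrices\<close>

definition eigenvalues :: "'a::field^'n^'n \<Rightarrow> 'a set" where
  "eigenvalues A = {c. \<exists>v. v \<noteq> 0 \<and> A *v v = c *s v}"

abbreviation complex_matrix :: "real^'n^'m \<Rightarrow> complex^'n^'m" where
  "complex_matrix \<equiv> map_matrix complex_of_real"

text \<open>The real spectrum of a symmetric matrix is finite and nonempty; the two functions below
  are meant for symmetric arguments only.\<close>

definition lambda_max :: "real^'n^'n \<Rightarrow> real" where
  "lambda_max S = Max (eigenvalues S)"

definition lambda_min :: "real^'n^'n \<Rightarrow> real" where
  "lambda_min S = Min (eigenvalues S)"

text \<open>The largest singular value, i.e. the largest square root of an eigenvalue of
  \<open>transpose M ** M\<close>.\<close>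

definition spectral_norm :: "real^'n^'m \<Rightarrow> real" where
  "spectral_norm M = sqrt (lambda_max (transpose M ** M))"

definition pos_def :: "real^'n^'n \<Rightarrow> bool" where
  "pos_def S \<longleftrightarrow> transpose S = S \<and> (\<forall>x. x \<noteq> 0 \<longrightarrow> x \<bullet> (S *v x) > 0)"


section \<open>Differentiability\<close>

definition gradient :: "('a::real_inner \<Rightarrow> real) \<Rightarrow> 'a \<Rightarrow> 'a" where
  "gradient f x = (THE D. GDERIV f x :> D)"

definition cont_differentiable_on ::
    "(real^'a \<Rightarrow> real^'b) \<Rightarrow> (real^'a) set \<Rightarrow> bool" where
  "cont_differentiable_on f S \<longleftrightarrow> open S \<and>
     (\<exists>J. continuous_on S J \<and> (\<forall>x\<in>S. (f has_derivative (\<lambda>v. J x *v v)) (at x)))"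

definition cont_differentiable :: "('a::real_inner \<Rightarrow> real) \<Rightarrow> bool" where
  "cont_differentiable f \<longleftrightarrow> (\<forall>x. \<exists>D. GDERIV f x :> D) \<and> continuous_on UNIV (gradient f)"

definition forward_invariant ::
    "('a::real_normed_vector \<Rightarrow> 'a) \<Rightarrow> 'a set \<Rightarrow> bool" where
  "forward_invariant \<phi> W \<longleftrightarrow>
     (\<forall>T w. (\<forall>t\<in>{0..T}. (w has_vector_derivative \<phi> (w t)) (at t within {0..T})) \<and> w 0 \<in> W
        \<longrightarrow> (\<forall>t\<in>{0..T}. w t \<in> W))"

text \<open>Absolute continuity of functions of a real variable (the library constant
  \<open>absolutely_continuous\<close> concerns measures).  The families of non-overlapping compact
  intervals are given by \<open>division_of\<close>.\<close>

definition abs_continuous_on :: "real set \<Rightarrow> (real \<Rightarrow> 'a::real_normed_vector) \<Rightarrow> bool" where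
  "abs_continuous_on S f \<longleftrightarrow>
     (\<forall>e>0. \<exists>d>0. \<forall>\<D>. \<D> division_of \<Union>\<D> \<and> \<Union>\<D> \<subseteq> S \<and> (\<Sum>k\<in>\<D>. measure lborel k) < d
        \<longrightarrow> (\<Sum>k\<in>\<D>. norm (f (Sup k) - f (Inf k))) < e)"

definition locally_abs_continuous_on :: "real set \<Rightarrow> (real \<Rightarrow> 'a::real_normed_vector) \<Rightarrow> bool"
  where "locally_abs_continuous_on S f \<longleftrightarrow> (\<forall>a b. {a..b} \<subseteq> S \<longrightarrow> abs_continuous_on {a..b} f)"


section \<open>Hybrid systems\<close>

record 'a hybrid_system =
  flow_set :: "'a set"
  flow_map :: "'a \<Rightarrow> 'a set"
  jump_set :: "'a set"
  jump_map :: "'a \<Rightarrow> 'a set"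

definition compact_hybrid_time_domain :: "(real \<times> nat) set \<Rightarrow> bool" where
  "compact_hybrid_time_domain D \<longleftrightarrow>
     (\<exists>J t. t 0 = 0 \<and> (\<forall>j<J. t j \<le> t (Suc j)) \<and> D = (\<Union>j<J. {t j..t (Suc j)} \<times> {j}))"

definition hybrid_time_domain :: "(real \<times> nat) set \<Rightarrow> bool" where
  "hybrid_time_domain D \<longleftrightarrow> D \<subseteq> {0..} \<times> UNIV \<and>
     (\<forall>(T, J)\<in>D. compact_hybrid_time_domain (D \<inter> ({0..T} \<times> {0..J})))"

definition flow_times :: "(real \<times> nat) set \<Rightarrow> nat \<Rightarrow> real set" where
  "flow_times D j = {t. (t, j) \<in> D}"

text \<open>A hybrid arc is represented by its domain \<open>D\<close> and a total function \<open>p\<close> whose values off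
  \<open>D\<close> are irrelevant.  As \<open>p 0 0\<close> has to be defined, the domain is nonempty.\<close>

definition hybrid_solution ::
    "'a::real_normed_vector hybrid_system \<Rightarrow> (real \<times> nat) set \<Rightarrow> (real \<Rightarrow> nat \<Rightarrow> 'a) \<Rightarrow> bool" where
  "hybrid_solution H D p \<longleftrightarrow>
     hybrid_time_domain D \<and> (0, 0) \<in> D \<and> p 0 0 \<in> closure (flow_set H) \<union> jump_set H \<and>
     (\<forall>j. interior (flow_times D j) \<noteq> {} \<longrightarrow>
        locally_abs_continuous_on (flow_times D j) (\<lambda>t. p t j) \<and>
        (\<forall>t\<in>interior (flow_times D j). p t j \<in> flow_set H) \<and>
        (AE t in lebesgue. t \<in> flow_times D j \<longrightarrow>
           (\<exists>v\<in>flow_map H (p t j).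
              ((\<lambda>r. p r j) has_vector_derivative v) (at t within flow_times D j)))) \<and>
     (\<forall>t j. (t, j) \<in> D \<and> (t, Suc j) \<in> D \<longrightarrow>
        p t j \<in> jump_set H \<and> p t (Suc j) \<in> jump_map H (p t j))"

definition UGES :: "'a::real_normed_vector hybrid_system \<Rightarrow> 'a set \<Rightarrow> bool" where
  "UGES H \<A> \<longleftrightarrow> compact \<A> \<and> \<A> \<subseteq> flow_set H \<union> jump_set H \<and>
     (\<exists>c1>0. \<exists>c2>0. \<forall>D p. hybrid_solution H D p \<longrightarrow>
        (\<forall>(t, j)\<in>D. infdist (p t j) \<A> \<le> c1 * infdist (p 0 0) \<A> * exp (- c2 * (t + real j))))"


section \<open>Feedback optimization under attacks on the static feedback\<close>

text \<open>States are tuples \<open>(x, u, \<tau>1, \<tau>2, \<sigma>, w)\<close>; the norm of the product type is the Euclidean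
  one.  Modes are natural numbers, embedded into the reals as a component of the state.\<close>

type_synonym ('n, 'm, 'q) state = "(real^'n) \<times> (real^'m) \<times> real \<times> real \<times> real \<times> (real^'q)"

text \<open>The arguments \<open>A\<close>, \<open>B\<close>, \<open>E\<close> are the mode-dependent matrices, \<open>s\<close> is the nominal mode,
  \<open>Sa\<close> the set of attack modes, and \<open>\<phi>\<close> the vector field generating \<open>w\<close>.\<close>

definition attacked_system ::
    "(nat \<Rightarrow> real^'n^'n) \<Rightarrow> (nat \<Rightarrow> real^'m^'n) \<Rightarrow> (nat \<Rightarrow> real^'q^'n) \<Rightarrow> real^'n^'p \<Rightarrow> real^'m^'p
     \<Rightarrow> (real^'m \<Rightarrow> real) \<Rightarrow> (real^'p \<Rightarrow> real) \<Rightarrow> nat \<Rightarrow> nat set \<Rightarrow> (real^'q) set \<Rightarrow> (real^'q \<Rightarrow> real^'q)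
     \<Rightarrow> nat \<Rightarrow> real \<Rightarrow> real \<Rightarrow> real \<Rightarrow> real \<Rightarrow> ('n::finite, 'm::finite, 'q::finite) state hybrid_system"
  where
  "attacked_system A B E C G fu fy s Sa W \<phi> N0 T0 \<kappa>1 \<kappa>2 \<epsilon> =
     \<lparr> flow_set = UNIV \<times> UNIV \<times> {0..real N0} \<times> {0..T0} \<times> real ` insert s Sa \<times> W,
       flow_map = (\<lambda>(x, u, \<tau>1, \<tau>2, \<sigma>, w).
         {(A i *v x + B i *v u + E i *v w,
           - (\<epsilon> *\<^sub>R (gradient fu u + transpose G *v gradient fy (C *v x))),
           d1, d2 - indicator Sa i, 0, \<phi> w) | i d1 d2.
           i \<in> insert s Sa \<and> \<sigma> = real i \<and> d1 \<in> {0..\<kappa>1} \<and> d2 \<in> {0..\<kappa>2}}),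
       jump_set = UNIV \<times> UNIV \<times> {1..real N0} \<times> {0..T0} \<times> real ` insert s Sa \<times> W,
       jump_map = (\<lambda>(x, u, \<tau>1, \<tau>2, \<sigma>, w).
         {(x, u, \<tau>1 - 1, \<tau>2, \<sigma>', w) | \<sigma>'. \<sigma>' \<in> real ` insert s Sa - {\<sigma>}}) \<rparr>"

end

theory Submission
  imports Defs
begin

text \<open>Let \<open>z\<close> be the deviation of \<open>x\<close> from its quasi-steady state, and let \<open>Q\<close> be \<open>P\<close> in the nominal
  mode and \<open>\<beta>\<close> times the identity in the attack modes.  Along the flow with frozen input,
  \<open>z \<bullet> Q z\<close> decays at rate \<open>lambda_min R / lambda_max P\<close> in the nominal mode, grows at rate at most
  \<open>eig_a\<close> under attack, and jumps by at most the factor \<open>\<omega>\<close>.  Multiplying by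
  \<open>exp (ln \<omega> * \<tau>1 + (lambda_min R / lambda_max P + eig_a) * \<tau>2)\<close>, which lies between \<open>1\<close> and
  \<open>exp \<tau>0\<close>, turns this into decay at rate \<open>\<rho>\<close> without increase at jumps.  Adding the
  suboptimality gap of \<open>u\<close> gives a Lyapunov function of the feedback interconnection: the
  Polyak-Lojasiewicz inequality implies \<open>\<mu> \<le> l\<close>, so the bound on \<open>\<epsilon>\<close> yields the small-gain
  condition of lemma \<open>interconnection_decay\<close>.  A last factor \<open>exp (\<eta> * \<tau>1)\<close> trades part of the
  decay along flows for strict decay at jumps.\<close>

section \<open>Symmetric matrices\<close>

text \<open>Solutions are only absolutely continuous, so every differential inequality holds merely
  almost everywhere, and integrating it takes the gauge argument of
  \<open>nonincreasing_if_derivative_nonpos_AE\<close>. Mode and disturbance are components of the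
  state with zero velocity; being constant on each flow interval, they can be frozen as parameters
  of a smooth Lyapunov function. The attractor, however, collects the equilibria of all
  \<open>w\<close>, and the point nearest to a state may belong to another \<open>w\<close>; the
  upper distance bound therefore needs a minimizer that is Lipschitz in \<open>w\<close>. The cost
  is not assumed convex: this Lipschitz property and \<open>\<mu> \<le> l\<close> both rest on the
  quadratic growth that the Polyak-Lojasiewicz inequality implies at a unique minimizer. Finally
  \<open>\<mu>\<^sup>2 + l\<^sup>2\<close> in the bound on \<open>\<epsilon>\<close> is at least
  \<open>2 * \<mu>\<^sup>2\<close>, which cancels the \<open>\<mu>\<^sup>2\<close> of the numerator
  and leaves the factor 4 of the small-gain condition.\<close>

lemma matrix_vector_mult_minus_left:
  fixes S :: "real^'n^'m"
  shows "(- S) *v v = - (S *v v)"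
  by (simp add: vec_eq_iff matrix_vector_mult_def sum_negf)

lemma inner_transpose_mult:
  fixes S :: "real^'n^'m"
  shows "(transpose S *v y) \<bullet> x = y \<bullet> (S *v x)"
  by (metis dot_lmul_matrix transpose_matrix_vector)

lemma inner_symmetric_mult:
  fixes S :: "real^'n^'n"
  assumes "transpose S = S"
  shows "(S *v x) \<bullet> y = x \<bullet> (S *v y)"
  by (metis assms inner_transpose_mult)

text \<open>Nonnegativity on the span of \<open>x\<close> and \<open>y\<close> suffices, as for an
  inner product; since the form may be degenerate, the case \<open>y \<bullet> (S *v y) = 0\<close>
  is treated apart.\<close>

lemma psd_cauchy_schwarz:
  fixes S :: "real^'n^'n"
  assumes sym: "transpose S = S" and psd: "\<And>x. 0 \<le> x \<bullet> (S *v x)"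
  shows "(x \<bullet> (S *v y))\<^sup>2 \<le> (x \<bullet> (S *v x)) * (y \<bullet> (S *v y))"
proof -
  define a b c where "a = x \<bullet> (S *v x)" and "b = x \<bullet> (S *v y)" and "c = y \<bullet> (S *v y)"
  have b': "y \<bullet> (S *v x) = b"
    by (metis b_def inner_commute inner_symmetric_mult sym)
  have form: "0 \<le> s\<^sup>2 * a + 2 * s * t * b + t\<^sup>2 * c" for s t
  proof -
    have "(s *\<^sub>R x + t *\<^sub>R y) \<bullet> (S *v (s *\<^sub>R x + t *\<^sub>R y)) = s\<^sup>2 * a + 2 * s * t * b + t\<^sup>2 * c"
      using b' by (simp add: matrix_vector_right_distrib matrix_vector_mult_scaleR inner_add_left
          inner_add_right a_def b_def c_def power2_eq_square algebra_simps)
    then show ?thesis by (metis psd)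
  qed
  have "b\<^sup>2 \<le> a * c"
  proof (cases "c = 0")
    case True
    have "b = 0"
    proof (rule ccontr)
      assume "b \<noteq> 0"
      \<comment> \<open>With \<open>c = 0\<close> and \<open>s = 1\<close> the form is affine in
        \<open>t\<close>, and this \<open>t\<close> gives it the value \<open>-1\<close>.\<close>
      then show False using form[of 1 "- (a + 1) / (2 * b)"] True
        by (simp add: field_simps)
    qed
    then show ?thesis using True by simp
  next
    case False
    then have "c > 0" using psd[of y] by (simp add: c_def)
    moreover have "0 \<le> c * (a * c - b\<^sup>2)"
      using form[of c "- b"] by (simp add: power2_eq_square algebra_simps)
    ultimately show ?thesis by (simp add: zero_le_mult_iff)
  qed
  then show ?thesis by (simp add: a_def b_def c_def)
qed

text \<open>A maximizer \<open>v\<close> of the form on the unit sphere is an eigenvector: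
  \<open>T = c I - S\<close> is positive semidefinite with \<open>v \<bullet> (T *v v) = 0\<close>,
  and Cauchy-Schwarz for \<open>T\<close> forces \<open>T *v v = 0\<close>. In particular the
  spectrum is nonempty.\<close>

lemma rayleigh_maximum:
  fixes S :: "real^'n^'n"
  assumes sym: "transpose S = S"
  obtains c where "c \<in> eigenvalues S" "\<And>x. x \<bullet> (S *v x) \<le> c * (norm x)\<^sup>2"
proof -
  have cont: "continuous_on (sphere 0 1) (\<lambda>x. x \<bullet> (S *v x))"
    by (intro continuous_intros)
  have ne: "sphere (0 :: real^'n) 1 \<noteq> {}" by simp
  obtain v where v: "norm v = 1" "\<And>y. norm y = 1 \<Longrightarrow> y \<bullet> (S *v y) \<le> v \<bullet> (S *v v)"
    using continuous_attains_sup[OF compact_sphere ne cont] by (auto simp: dist_norm)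
  define c where "c = v \<bullet> (S *v v)"
  have bound: "x \<bullet> (S *v x) \<le> c * (norm x)\<^sup>2" for x
  proof (cases "x = 0")
    case False
    have "norm (x /\<^sub>R norm x) = 1" using False by simp
    then have "(x /\<^sub>R norm x) \<bullet> (S *v (x /\<^sub>R norm x)) \<le> c"
      unfolding c_def by (rule v(2))
    then show ?thesis
      using False by (simp add: matrix_vector_mult_scaleR field_simps power2_eq_square)
  qed simp
  define T where "T = c *\<^sub>R mat 1 - S"
  have T: "T *v x = c *\<^sub>R x - S *v x" for x
    by (simp add: T_def matrix_vector_mult_diff_rdistrib flip: scaleR_matrix_vector_assoc)
  have Tsym: "transpose T = T"
    using sym by (auto simp: T_def transpose_def mat_def vec_eq_iff)
  have Tpsd: "0 \<le> x \<bullet> (T *v x)" for x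
    using bound[of x] by (simp add: T inner_diff_right power2_norm_eq_inner)
  have Tv: "v \<bullet> (T *v v) = 0"
    using v(1) by (simp add: T inner_diff_right c_def flip: power2_norm_eq_inner)
  have "(T *v v) \<bullet> (T *v v) = v \<bullet> (T *v (T *v v))"
    by (rule inner_symmetric_mult[OF Tsym])
  also have "\<dots> = 0"
    using psd_cauchy_schwarz[OF Tsym Tpsd, of v "T *v v"] Tv by simp
  finally have "S *v v = c *s v" by (simp add: T scalar_mult_eq_scaleR)
  moreover have "v \<noteq> 0" using v(1) by auto
  ultimately show ?thesis using that[of c] bound by (auto simp: eigenvalues_def)
qed

text \<open>Eigenvectors of distinct eigenvalues are orthogonal, hence linearly independent, so
  there are only finitely many. This is what gives \<open>Max\<close> and \<open>Min\<close> of the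
  spectrum a meaning.\<close>

lemma finite_eigenvalues_symmetric:
  fixes S :: "real^'n^'n"
  assumes sym: "transpose S = S"
  shows "finite (eigenvalues S)"
proof -
  have "\<forall>c\<in>eigenvalues S. \<exists>v. v \<noteq> 0 \<and> S *v v = c *\<^sub>R v"
    by (simp add: eigenvalues_def scalar_mult_eq_scaleR)
  from bchoice[OF this] obtain e
    where e: "\<And>c. c \<in> eigenvalues S \<Longrightarrow> e c \<noteq> 0 \<and> S *v e c = c *\<^sub>R e c"
    by blast
  have orth: "e c \<bullet> e d = 0" if "c \<in> eigenvalues S" "d \<in> eigenvalues S" "c \<noteq> d" for c d
  proof -
    have "c * (e c \<bullet> e d) = d * (e c \<bullet> e d)"
      using inner_symmetric_mult[OF sym, of "e c" "e d"] that e by simp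
    with that show ?thesis by simp
  qed
  have inj: "inj_on e (eigenvalues S)"
    by (metis e inj_onI inner_eq_zero_iff orth)
  have "pairwise orthogonal (e ` eigenvalues S)"
    by (auto simp: pairwise_def orthogonal_def intro!: orth)
  moreover have "0 \<notin> e ` eigenvalues S" using e by auto
  ultimately have "finite (e ` eigenvalues S)"
    using pairwise_orthogonal_independent independent_imp_finite by blast
  then show ?thesis using inj by (simp add: finite_image_iff)
qed

lemma lambda_max_upper:
  fixes S :: "real^'n^'n"
  assumes "transpose S = S"
  shows "x \<bullet> (S *v x) \<le> lambda_max S * (norm x)\<^sup>2"
proof -
  obtain c where c: "c \<in> eigenvalues S" "\<And>x. x \<bullet> (S *v x) \<le> c * (norm x)\<^sup>2"
    using rayleigh_maximum[OF assms] by blast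
  have "c \<le> lambda_max S"
    unfolding lambda_max_def using c(1) finite_eigenvalues_symmetric[OF assms] by simp
  then show ?thesis using c(2)[of x] by (meson mult_right_mono order_trans zero_le_power2)
qed

text \<open>Negation reverses the spectrum, so facts about the smallest eigenvalue reduce to those
  about the largest.\<close>

lemma lambda_min_eq:
  fixes S :: "real^'n^'n"
  assumes "transpose S = S"
  shows "lambda_min S = - lambda_max (- S)"
proof -
  have sym: "transpose (- S) = - S"
    using assms by (auto simp: transpose_def vec_eq_iff)
  have eq: "eigenvalues S = uminus ` eigenvalues (- S)"
  proof -
    have "c \<in> eigenvalues S \<longleftrightarrow> - c \<in> eigenvalues (- S)" for c
      by (auto simp: eigenvalues_def matrix_vector_mult_minus_left)
    then show ?thesis by (force simp: image_iff)
  qed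
  have ne: "eigenvalues (- S) \<noteq> {}" using rayleigh_maximum[OF sym] by blast
  have fin: "finite (eigenvalues (- S))" by (rule finite_eigenvalues_symmetric[OF sym])
  show ?thesis
    unfolding lambda_min_def lambda_max_def
  proof (rule Min_eqI)
    show "finite (eigenvalues S)" unfolding eq using fin by simp
    show "- Max (eigenvalues (- S)) \<in> eigenvalues S"
      unfolding eq using Max_in[OF fin ne] by simp
    show "- Max (eigenvalues (- S)) \<le> y" if "y \<in> eigenvalues S" for y
      using that fin unfolding eq by auto
  qed
qed

lemma lambda_min_lower:
  fixes S :: "real^'n^'n"
  assumes "transpose S = S"
  shows "lambda_min S * (norm x)\<^sup>2 \<le> x \<bullet> (S *v x)"
proof -
  have sym: "transpose (- S) = - S"
    using assms by (auto simp: transpose_def vec_eq_iff)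
  show ?thesis
    using lambda_max_upper[OF sym, of x] unfolding lambda_min_eq[OF assms] matrix_vector_mult_minus_left by simp
qed

lemma lambda_min_le_max:
  fixes S :: "real^'n^'n"
  assumes "transpose S = S"
  shows "lambda_min S \<le> lambda_max S"
proof -
  obtain v :: "real^'n" where v: "norm v = 1" using vector_choose_size[of 1] by auto
  show ?thesis using lambda_min_lower[OF assms, of v] lambda_max_upper[OF assms, of v] v by simp
qed

lemma lambda_min_pos:
  fixes S :: "real^'n^'n"
  assumes "pos_def S"
  shows "0 < lambda_min S"
proof -
  have sym: "transpose S = S" using assms by (simp add: pos_def_def)
  have sym': "transpose (- S) = - S"
    using sym by (auto simp: transpose_def vec_eq_iff)
  have ne: "eigenvalues (- S) \<noteq> {}" using rayleigh_maximum[OF sym'] by blast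
  have "lambda_max (- S) \<in> eigenvalues (- S)"
    unfolding lambda_max_def using Max_in[OF finite_eigenvalues_symmetric[OF sym'] ne] .
  then obtain v where v: "v \<noteq> 0" "S *v v = lambda_min S *\<^sub>R v"
    unfolding eigenvalues_def lambda_min_eq[OF sym] matrix_vector_mult_minus_left mem_Collect_eq scalar_mult_eq_scaleR
    by (metis minus_equation_iff scaleR_minus_left)
  have "0 < v \<bullet> (S *v v)" using assms v(1) by (simp add: pos_def_def)
  then have "0 < lambda_min S * (v \<bullet> v)" by (simp add: v(2))
  then show ?thesis using inner_ge_zero[of v] by (simp add: zero_less_mult_iff)
qed

text \<open>Cauchy-Schwarz for the form at \<open>x\<close> and \<open>y = S *v x\<close> bounds
  \<open>norm y ^ 4\<close> by the product of the two quadratic values, and a factor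
  \<open>norm y ^ 2\<close> cancels. This turns Rayleigh bounds on the Lyapunov matrix into a bound
  on coupling terms.\<close>

lemma psd_norm_mult_le:
  fixes S :: "real^'n^'n"
  assumes sym: "transpose S = S" and psd: "\<And>x. 0 \<le> x \<bullet> (S *v x)"
    and ub: "\<And>x. x \<bullet> (S *v x) \<le> c * (norm x)\<^sup>2"
  shows "norm (S *v x) \<le> c * norm x"
proof -
  define y where "y = S *v x"
  have "(norm y)\<^sup>2 = x \<bullet> (S *v y)"
    using inner_symmetric_mult[OF sym, of x y] by (simp only: y_def power2_norm_eq_inner)
  then have "(norm y)\<^sup>2 * (norm y)\<^sup>2 = (x \<bullet> (S *v y))\<^sup>2"
    by (simp add: power2_eq_square)
  also have "\<dots> \<le> (x \<bullet> (S *v x)) * (y \<bullet> (S *v y))"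
    by (rule psd_cauchy_schwarz[OF sym psd])
  also have "\<dots> \<le> (c * (norm x)\<^sup>2) * (c * (norm y)\<^sup>2)"
    by (intro mult_mono ub psd order_trans[OF psd ub])
  finally have *: "(norm y)\<^sup>2 * (norm y)\<^sup>2 \<le> (c * norm x)\<^sup>2 * (norm y)\<^sup>2"
    by (simp add: power_mult_distrib power2_eq_square mult_ac)
  have c: "0 \<le> c * norm x"
  proof (cases "x = 0")
    case False
    then have "0 < (norm x)\<^sup>2" by simp
    with order_trans[OF psd ub, of x] have "0 \<le> c" by (simp add: zero_le_mult_iff)
    then show ?thesis by simp
  qed simp
  show ?thesis
  proof (cases "y = 0")
    case False
    then have "(norm y)\<^sup>2 \<le> (c * norm x)\<^sup>2" using mult_right_le_imp_le[OF *] by simp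
    then show ?thesis using c unfolding y_def by (rule power2_le_imp_le)
  qed (use c in \<open>simp add: y_def\<close>)
qed

text \<open>The transpose is handled without comparing the two Gram spectra: the squared norm of
  \<open>transpose M *v y\<close> is the inner product of \<open>y\<close> with \<open>M\<close>
  applied to that vector, and after the bound for \<open>M\<close> one factor cancels.\<close>

lemma spectral_norm_bounds:
  fixes M :: "real^'n^'m"
  shows spectral_norm_nonneg: "0 \<le> spectral_norm M"
    and norm_mult_le_spectral_norm: "norm (M *v x) \<le> spectral_norm M * norm x"
    and norm_transpose_mult_le_spectral_norm: "norm (transpose M *v y) \<le> spectral_norm M * norm y"
proof -
  have sym: "transpose (transpose M ** M) = transpose M ** M"
    by (simp add: matrix_transpose_mul)
  have sq: "x \<bullet> ((transpose M ** M) *v x) = (norm (M *v x))\<^sup>2" for x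
    by (metis dot_lmul_matrix inner_commute matrix_vector_mul_assoc power2_norm_eq_inner
        transpose_matrix_vector)
  have bd: "(norm (M *v x))\<^sup>2 \<le> lambda_max (transpose M ** M) * (norm x)\<^sup>2" for x
    using lambda_max_upper[OF sym, of x] by (simp add: sq)
  obtain v :: "real^'n" where v: "norm v = 1" using vector_choose_size[of 1] by auto
  have pos: "0 \<le> lambda_max (transpose M ** M)"
    using order_trans[OF zero_le_power2 bd[of v]] v by simp
  then show nn: "0 \<le> spectral_norm M" by (simp add: spectral_norm_def)
  have *: "norm (M *v x) \<le> spectral_norm M * norm x" for x
  proof (rule power2_le_imp_le)
    show "(norm (M *v x))\<^sup>2 \<le> (spectral_norm M * norm x)\<^sup>2"
      using bd[of x] pos by (simp add: spectral_norm_def power_mult_distrib)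
  qed (simp add: nn)
  then show "norm (M *v x) \<le> spectral_norm M * norm x" .
  have "(norm (transpose M *v y))\<^sup>2 = y \<bullet> (M *v (transpose M *v y))"
    by (simp only: inner_transpose_mult power2_norm_eq_inner)
  also have "\<dots> \<le> norm y * (spectral_norm M * norm (transpose M *v y))"
    using norm_cauchy_schwarz *[of "transpose M *v y"]
    by (meson mult_left_mono norm_ge_zero order_trans)
  finally show "norm (transpose M *v y) \<le> spectral_norm M * norm y"
    using nn by (cases "transpose M *v y = 0") (auto simp: power2_eq_square mult_ac)
qed

text \<open>With \<open>v = x + i y\<close>, testing the real and imaginary parts of the eigenvalue
  equation against \<open>x\<close> and \<open>y\<close> cancels the terms with \<open>Im z\<close>,
  so \<open>Re z\<close> is a weighted mean of Rayleigh quotients. An unstable attack mode thus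
  forces \<open>0 \<le> eig_a\<close>.\<close>

lemma Re_eigenvalue_le_lambda_max:
  fixes S :: "real^'n^'n"
  assumes "z \<in> eigenvalues (complex_matrix S)"
  shows "2 * Re z \<le> lambda_max (transpose S + S)"
proof -
  obtain v where v: "v \<noteq> 0" "complex_matrix S *v v = z *s v"
    using assms by (auto simp: eigenvalues_def)
  define x y where "x = (\<chi> i. Re (v $ i))" and "y = (\<chi> i. Im (v $ i))"
  have comp: "(complex_matrix S *v v) $ i = z * v $ i" for i
    using v(2) by simp
  have Sx: "S *v x = Re z *\<^sub>R x - Im z *\<^sub>R y"
  proof (rule vec_eq_iff[THEN iffD2], rule allI)
    fix i
    show "(S *v x) $ i = (Re z *\<^sub>R x - Im z *\<^sub>R y) $ i"
      using arg_cong[OF comp[of i], of Re]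
      by (simp add: matrix_vector_mult_def map_matrix_def x_def y_def)
  qed
  have Sy: "S *v y = Re z *\<^sub>R y + Im z *\<^sub>R x"
  proof (rule vec_eq_iff[THEN iffD2], rule allI)
    fix i
    show "(S *v y) $ i = (Re z *\<^sub>R y + Im z *\<^sub>R x) $ i"
      using arg_cong[OF comp[of i], of Im]
      by (simp add: matrix_vector_mult_def map_matrix_def x_def y_def)
  qed
  have sym: "transpose (transpose S + S) = transpose S + S"
    by (auto simp: transpose_def vec_eq_iff)
  have form: "w \<bullet> ((transpose S + S) *v w) = 2 * (w \<bullet> (S *v w))" for w
    using inner_transpose_mult[of S w w]
    by (simp only: matrix_vector_mult_add_rdistrib inner_add_right inner_commute)
  have "2 * Re z * ((norm x)\<^sup>2 + (norm y)\<^sup>2) = 2 * (x \<bullet> (S *v x)) + 2 * (y \<bullet> (S *v y))"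
    by (simp add: Sx Sy inner_diff_right inner_add_right power2_norm_eq_inner algebra_simps
        inner_commute)
  also have "\<dots> \<le> lambda_max (transpose S + S) * ((norm x)\<^sup>2 + (norm y)\<^sup>2)"
    using lambda_max_upper[OF sym, of x] lambda_max_upper[OF sym, of y]
    unfolding form by (simp add: algebra_simps)
  finally have *: "2 * Re z * ((norm x)\<^sup>2 + (norm y)\<^sup>2)
      \<le> lambda_max (transpose S + S) * ((norm x)\<^sup>2 + (norm y)\<^sup>2)" .
  have "x \<noteq> 0 \<or> y \<noteq> 0"
    using v(1) by (auto simp: x_def y_def vec_eq_iff complex_eq_iff)
  then have "0 < (norm x)\<^sup>2 + (norm y)\<^sup>2"
    by (auto simp: add_nonneg_pos add_pos_nonneg)
  with * show ?thesis by simp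
qed

section \<open>Invertibility from the Lyapunov equation\<close>

lemma matrix_inv_right:
  fixes A :: "real^'n^'n"
  assumes "\<And>x. A *v x = 0 \<Longrightarrow> x = 0"
  shows "A ** matrix_inv A = mat 1"
proof -
  obtain A' where "A' ** A = mat 1" using matrix_left_invertible_ker[of A] assms by blast
  then have "A ** A' = mat 1 \<and> A' ** A = mat 1" by (simp add: matrix_left_right_inverse)
  then show ?thesis unfolding matrix_inv_def by (metis (mono_tags, lifting) someI_ex)
qed

text \<open>At a kernel vector of \<open>A\<close> the form of the left-hand side vanishes, whereas
  that of \<open>- R\<close> is negative off \<open>0\<close>. Hence \<open>matrix_inv A\<close> is
  a genuine inverse in the formulas for \<open>G\<close>, \<open>H\<close> and the
  equilibrium.\<close>

lemma lyapunov_equation_kernel: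
  fixes A :: "real^'n^'n"
  assumes "pos_def R" "transpose A ** P + P ** A = - R" "A *v x = 0"
  shows "x = 0"
proof (rule ccontr)
  assume "x \<noteq> 0"
  then have "0 < x \<bullet> (R *v x)" using assms(1) by (simp add: pos_def_def)
  have "(- R) *v x = transpose A *v (P *v x) + P *v (A *v x)"
    unfolding assms(2)[symmetric] by (simp add: matrix_vector_mult_add_rdistrib matrix_vector_mul_assoc)
  then have "x \<bullet> ((- R) *v x) = (A *v x) \<bullet> (P *v x)"
    using assms(3) inner_transpose_mult[of A "P *v x" x]
    by (simp add: inner_commute del: transpose_matrix_vector)
  moreover have "(- R) *v x = - (R *v x)"
    by (rule matrix_vector_mult_minus_left)
  ultimately show False using \<open>0 < x \<bullet> (R *v x)\<close> assms(3) by simp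
qed

section \<open>Absolutely continuous functions\<close>

lemma abs_continuous_onD:
  assumes "abs_continuous_on S f" "e > 0"
  shows "\<exists>d>0. \<forall>\<D>. \<D> division_of \<Union>\<D> \<and> \<Union>\<D> \<subseteq> S \<and> (\<Sum>k\<in>\<D>. measure lborel k) < d
    \<longrightarrow> (\<Sum>k\<in>\<D>. norm (f (Sup k) - f (Inf k))) < e"
  using assms unfolding abs_continuous_on_def by blast

lemma abs_continuous_on_subset:
  "abs_continuous_on S f \<Longrightarrow> T \<subseteq> S \<Longrightarrow> abs_continuous_on T f"
  unfolding abs_continuous_on_def by (meson subset_trans)

lemma abs_continuous_on_imp_continuous_on:
  fixes f :: "real \<Rightarrow> 'a::real_normed_vector"
  assumes ac: "abs_continuous_on {a..b} f"
  shows "continuous_on {a..b} f"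
  unfolding continuous_on_iff
proof (intro ballI allI impI)
  fix x e :: real assume x: "x \<in> {a..b}" and "0 < e"
  obtain d where d: "d > 0" "\<forall>\<D>. \<D> division_of \<Union>\<D> \<and> \<Union>\<D> \<subseteq> {a..b} \<and> (\<Sum>k\<in>\<D>. measure lborel k) < d
      \<longrightarrow> (\<Sum>k\<in>\<D>. norm (f (Sup k) - f (Inf k))) < e"
    using abs_continuous_onD[OF ac \<open>0 < e\<close>] by blast
  have close: "norm (f v - f u) < e" if "u \<in> {a..b}" "v \<in> {a..b}" "u \<le> v" "v - u < d" for u v
  proof -
    have "{{u..v}} division_of \<Union>{{u..v}}"
      using division_of_self[of u v] that by simp
    then show ?thesis using d(2)[rule_format, of "{{u..v}}"] that by simp
  qed
  have "dist (f x') (f x) < e" if "x' \<in> {a..b}" "dist x' x < d" for x'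
    using close[of x x'] close[of x' x] x that
    by (cases "x \<le> x'") (auto simp: dist_norm dist_real_def norm_minus_commute)
  then show "\<exists>d>0. \<forall>x'\<in>{a..b}. dist x' x < d \<longrightarrow> dist (f x') (f x) < e"
    using d(1) by blast
qed

text \<open>Only increments along \<open>f\<close> are compared, so \<open>g\<close> may be the
  composition of \<open>f\<close> with a function that is Lipschitz merely on the range of
  \<open>f\<close>.\<close>

lemma abs_continuous_on_lipschitz_compose:
  fixes f :: "real \<Rightarrow> 'a::real_normed_vector" and g :: "real \<Rightarrow> 'b::real_normed_vector"
  assumes ac: "abs_continuous_on {a..b} f"
    and lip: "\<And>x y. \<lbrakk>x \<in> {a..b}; y \<in> {a..b}\<rbrakk> \<Longrightarrow> norm (g y - g x) \<le> L * norm (f y - f x)"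
  shows "abs_continuous_on {a..b} g"
  unfolding abs_continuous_on_def
proof (intro allI impI)
  fix e :: real assume "0 < e"
  then have e': "0 < e / (\<bar>L\<bar> + 1)" by (intro divide_pos_pos) auto
  obtain d where d: "d > 0"
    "\<forall>\<D>. \<D> division_of \<Union>\<D> \<and> \<Union>\<D> \<subseteq> {a..b} \<and> (\<Sum>k\<in>\<D>. measure lborel k) < d
      \<longrightarrow> (\<Sum>k\<in>\<D>. norm (f (Sup k) - f (Inf k))) < e / (\<bar>L\<bar> + 1)"
    using abs_continuous_onD[OF ac e'] by blast
  have "(\<Sum>k\<in>\<D>. norm (g (Sup k) - g (Inf k))) < e"
    if D: "\<D> division_of \<Union>\<D>" "\<Union>\<D> \<subseteq> {a..b}" "(\<Sum>k\<in>\<D>. measure lborel k) < d" for \<D>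
  proof -
    have "norm (g (Sup k) - g (Inf k)) \<le> (\<bar>L\<bar> + 1) * norm (f (Sup k) - f (Inf k))"
      if k: "k \<in> \<D>" for k
    proof -
      obtain u v where uv: "k = cbox u v" using division_ofD(4)[OF D(1) k] by auto
      moreover have "k \<noteq> {}" using division_ofD(3)[OF D(1) k] .
      ultimately have "k = {u..v}" "u \<le> v" by auto
      moreover have "k \<subseteq> {a..b}" using k D(2) by blast
      ultimately have "Sup k \<in> {a..b}" "Inf k \<in> {a..b}" by auto
      then have "norm (g (Sup k) - g (Inf k)) \<le> L * norm (f (Sup k) - f (Inf k))"
        by (intro lip)
      also have "\<dots> \<le> (\<bar>L\<bar> + 1) * norm (f (Sup k) - f (Inf k))"
        by (intro mult_right_mono) auto
      finally show ?thesis .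
    qed
    then have "(\<Sum>k\<in>\<D>. norm (g (Sup k) - g (Inf k)))
        \<le> (\<bar>L\<bar> + 1) * (\<Sum>k\<in>\<D>. norm (f (Sup k) - f (Inf k)))"
      unfolding sum_distrib_left by (rule sum_mono)
    also have "\<dots> < (\<bar>L\<bar> + 1) * (e / (\<bar>L\<bar> + 1))"
      using d(2)[rule_format, of \<D>] D by (intro mult_strict_left_mono) auto
    finally show ?thesis by simp
  qed
  then show "\<exists>d>0. \<forall>\<D>. \<D> division_of \<Union>\<D> \<and> \<Union>\<D> \<subseteq> {a..b} \<and> (\<Sum>k\<in>\<D>. measure lborel k) < d
      \<longrightarrow> (\<Sum>k\<in>\<D>. norm (g (Sup k) - g (Inf k))) < e"
    using d(1) by blast
qed

text \<open>Continuity bounds each directional derivative along a basis vector on a ball, and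
  summing over the finite basis bounds the operator norm. The ball replaces \<open>K\<close> because
  the mean value inequality needs a convex set.\<close>

lemma C1_imp_bounded_slope:
  fixes V :: "'a::euclidean_space \<Rightarrow> real"
  assumes der: "\<And>x. (V has_derivative DV x) (at x)"
    and cont: "\<And>h. continuous_on UNIV (\<lambda>x. DV x h)"
    and bdd: "bounded K"
  obtains L where "L \<ge> 0" "\<And>x y. \<lbrakk>x \<in> K; y \<in> K\<rbrakk> \<Longrightarrow> \<bar>V y - V x\<bar> \<le> L * norm (y - x)"
proof -
  obtain r where r: "K \<subseteq> cball 0 r" using bounded_subset_ballD[OF bdd, of 0] ball_subset_cball by blast
  have "\<exists>M. \<forall>x\<in>cball 0 r. \<bar>DV x b\<bar> \<le> M" for b
  proof -
    have "bounded ((\<lambda>x. DV x b) ` cball 0 r)"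
      by (intro compact_imp_bounded compact_continuous_image compact_cball
          continuous_on_subset[OF cont]) simp
    then show ?thesis by (auto simp: bounded_iff)
  qed
  then obtain M where M: "\<And>b x. x \<in> cball 0 r \<Longrightarrow> \<bar>DV x b\<bar> \<le> M b" by metis
  define L where "L = \<bar>\<Sum>b\<in>Basis. M b\<bar>"
  have on: "onorm (DV x) \<le> L" if x: "x \<in> cball 0 r" for x
  proof (rule onorm_le)
    fix h :: 'a
    have lin: "linear (DV x)" using der has_derivative_linear by blast
    have "DV x h = (\<Sum>b\<in>Basis. (h \<bullet> b) * DV x b)"
      using Linear_Algebra.linear_componentwise[OF lin, of h 1] by simp
    also have "\<bar>\<dots>\<bar> \<le> (\<Sum>b\<in>Basis. norm h * M b)"
      unfolding real_norm_def[symmetric]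
      by (intro sum_norm_le) (auto simp: abs_mult intro!: mult_mono Basis_le_norm M[OF x])
    also have "\<dots> \<le> norm h * L"
      unfolding L_def sum_distrib_left[symmetric] by (intro mult_left_mono) auto
    finally show "norm (DV x h) \<le> L * norm h" by (simp add: mult.commute)
  qed
  show ?thesis
  proof (rule that)
    show "0 \<le> L" by (simp add: L_def)
    show "\<bar>V y - V x\<bar> \<le> L * norm (y - x)" if "x \<in> K" "y \<in> K" for x y
    proof -
      have "norm (V y - V x) \<le> L * norm (y - x)"
      proof (rule differentiable_bound[of "cball 0 r" V DV])
        show "(V has_derivative DV z) (at z within cball 0 r)" for z
          by (rule has_derivative_at_withinI[OF der])
      qed (use on r that in auto)
      then show ?thesis by simp
    qed
  qed
qed

lemma abs_continuous_on_C1_compose: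
  fixes V :: "'a::euclidean_space \<Rightarrow> real"
  assumes "\<And>x. (V has_derivative DV x) (at x)"
    and "\<And>h. continuous_on UNIV (\<lambda>x. DV x h)"
    and ac: "abs_continuous_on {a..b} f"
  shows "abs_continuous_on {a..b} (\<lambda>t. V (f t))"
proof -
  have "bounded (f ` {a..b})"
    by (intro compact_imp_bounded compact_continuous_image abs_continuous_on_imp_continuous_on ac) simp
  from C1_imp_bounded_slope[OF assms(1,2) this] obtain L
    where "\<And>x y. \<lbrakk>x \<in> f ` {a..b}; y \<in> f ` {a..b}\<rbrakk> \<Longrightarrow> \<bar>V y - V x\<bar> \<le> L * norm (y - x)" by metis
  then show ?thesis
    by (intro abs_continuous_on_lipschitz_compose[OF ac, of _ L]) simp
qed

text \<open>Pairing with time makes \<open>exp (c * t) * V (p t)\<close> the composition of a C1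
  function with an absolutely continuous curve.\<close>

lemma abs_continuous_on_Pair_ident:
  fixes f :: "real \<Rightarrow> 'a::real_normed_vector"
  assumes ac: "abs_continuous_on {a..b} f"
  shows "abs_continuous_on {a..b} (\<lambda>t. (t, f t))"
  unfolding abs_continuous_on_def
proof (intro allI impI)
  fix e :: real assume "0 < e"
  then have e': "0 < e / 2" by simp
  obtain d where d: "d > 0"
    "\<forall>\<D>. \<D> division_of \<Union>\<D> \<and> \<Union>\<D> \<subseteq> {a..b} \<and> (\<Sum>k\<in>\<D>. measure lborel k) < d
      \<longrightarrow> (\<Sum>k\<in>\<D>. norm (f (Sup k) - f (Inf k))) < e / 2"
    using abs_continuous_onD[OF ac e'] by blast
  have "(\<Sum>k\<in>\<D>. norm ((Sup k, f (Sup k)) - (Inf k, f (Inf k)))) < e"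
    if D: "\<D> division_of \<Union>\<D>" "\<Union>\<D> \<subseteq> {a..b}" "(\<Sum>k\<in>\<D>. measure lborel k) < min d (e / 2)" for \<D>
  proof -
    have "norm ((Sup k, f (Sup k)) - (Inf k, f (Inf k)))
        \<le> measure lborel k + norm (f (Sup k) - f (Inf k))" if k: "k \<in> \<D>" for k
    proof -
      obtain u v where uv: "k = cbox u v" using division_ofD(4)[OF D(1) k] by auto
      moreover have "k \<noteq> {}" using division_ofD(3)[OF D(1) k] .
      ultimately have "k = {u..v}" "u \<le> v" by auto
      then show ?thesis using norm_Pair_le[of "v - u" "f v - f u"] by simp
    qed
    then have "(\<Sum>k\<in>\<D>. norm ((Sup k, f (Sup k)) - (Inf k, f (Inf k))))
        \<le> (\<Sum>k\<in>\<D>. measure lborel k) + (\<Sum>k\<in>\<D>. norm (f (Sup k) - f (Inf k)))"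
      unfolding sum.distrib[symmetric] by (rule sum_mono)
    then show ?thesis using d(2)[rule_format, of \<D>] D by simp
  qed
  then show "\<exists>d>0. \<forall>\<D>. \<D> division_of \<Union>\<D> \<and> \<Union>\<D> \<subseteq> {a..b} \<and> (\<Sum>k\<in>\<D>. measure lborel k) < d
      \<longrightarrow> (\<Sum>k\<in>\<D>. norm ((Sup k, f (Sup k)) - (Inf k, f (Inf k)))) < e"
    using d(1) \<open>0 < e\<close> by (intro exI[of _ "min d (e / 2)"]) auto
qed

text \<open>A gauge argument in the style of Henstock: off the null set, a small interval around its
  tag has slope at most \<open>e\<close>; intervals tagged in the null set lie in an open set of
  measure below \<open>d\<close>, where absolute continuity bounds the total increment by
  \<open>e\<close>. Additivity over a fine tagged division combines both.\<close>

lemma nonincreasing_if_derivative_nonpos_AE: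
  fixes f :: "real \<Rightarrow> real"
  assumes ac: "abs_continuous_on {a..b} f" and "a \<le> b"
    and ae: "AE t in lebesgue. t \<in> {a<..<b} \<longrightarrow> (\<exists>v\<le>0. (f has_real_derivative v) (at t))"
  shows "f b \<le> f a"
proof (rule field_le_epsilon)
  fix e' :: real assume "0 < e'"
  \<comment> \<open>Regular intervals will contribute at most \<open>e * (b - a)\<close>,
    exceptional ones at most \<open>e\<close>.\<close>
  define e where "e = e' / (b - a + 1)"
  have e: "0 < e" "e * (b - a) + e = e'"
  proof -
    show "0 < e" using \<open>0 < e'\<close> \<open>a \<le> b\<close> by (simp add: e_def)
    have "e * (b - a + 1) = e'" using \<open>a \<le> b\<close> by (simp add: e_def)
    then show "e * (b - a) + e = e'" by (simp add: algebra_simps)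
  qed
  obtain N where N: "N \<in> null_sets lebesgue"
    and off: "\<And>t. \<lbrakk>t \<in> {a<..<b}; t \<notin> N\<rbrakk> \<Longrightarrow> \<exists>v\<le>0. (f has_real_derivative v) (at t)"
    using ae by (auto elim!: AE_E3 simp: subset_iff)
  \<comment> \<open>The end points count as exceptional because derivatives are given in the open
    interval only.\<close>
  define Z where "Z = N \<union> {a, b}"
  have "Z \<in> null_sets lebesgue"
    unfolding Z_def by (intro null_sets.Un N) (auto simp: finite_imp_null_set_lborel null_sets_completionI)
  then have Z: "Z \<in> sets lebesgue" "emeasure lebesgue Z = 0" by auto
  obtain d where d: "d > 0"
    "\<forall>\<D>. \<D> division_of \<Union>\<D> \<and> \<Union>\<D> \<subseteq> {a..b} \<and> (\<Sum>k\<in>\<D>. measure lborel k) < d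
      \<longrightarrow> (\<Sum>k\<in>\<D>. norm (f (Sup k) - f (Inf k))) < e"
    using abs_continuous_onD[OF ac e(1)] by blast
  obtain T where T: "open T" "Z \<subseteq> T" "(T - Z) \<in> lmeasurable" "emeasure lebesgue (T - Z) < ennreal d"
    using sets_lebesgue_outer_open[OF Z(1) d(1)] by metis
  have Tm: "T \<in> sets lebesgue" using T(1) by simp
  have "emeasure lebesgue T = emeasure lebesgue (T - Z)"
    using emeasure_Diff_null_set[OF \<open>Z \<in> null_sets lebesgue\<close> Tm] by (rule sym)
  then have T_small: "emeasure lebesgue T < ennreal d" using T(4) by simp
  have Tl: "T \<in> lmeasurable"
    using Tm T_small by (intro fmeasurableI) (auto simp: order.strict_trans[OF _ ennreal_less_top])
  \<comment> \<open>Since \<open>u \<le> t \<le> v\<close>, the linearization errors at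
    \<open>u\<close> and \<open>v\<close> add up to \<open>e * (v - u)\<close>.\<close>
  define good where "good t r \<longleftrightarrow> (t \<in> Z \<longrightarrow> ball t r \<subseteq> T) \<and> (t \<in> {a..b} - Z \<longrightarrow>
      (\<forall>u v. u \<le> t \<and> t \<le> v \<and> u \<in> ball t r \<and> v \<in> ball t r \<longrightarrow> f v - f u \<le> e * (v - u)))" for t r
  have "\<exists>r>0. good t r" for t
  proof (cases "t \<in> Z")
    case True
    then show ?thesis using T(1,2) by (auto simp: good_def open_contains_ball)
  next
    case tZ: False
    show ?thesis
    proof (cases "t \<in> {a..b}")
      case True
      then have "t \<in> {a<..<b}" "t \<notin> N" using tZ by (auto simp: Z_def)
      then obtain v0 where v0: "v0 \<le> 0" "(f has_real_derivative v0) (at t)" using off by blast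
      then have "(f has_derivative (\<lambda>h. v0 * h)) (at t)" by (simp add: has_field_derivative_def)
      then obtain r where r: "r > 0"
        "\<And>y. norm (y - t) < r \<Longrightarrow> norm (f y - f t - v0 * (y - t)) \<le> e * norm (y - t)"
        using e(1) unfolding has_derivative_at_alt by metis
      have "f v - f u \<le> e * (v - u)"
        if "u \<le> t" "t \<le> v" "u \<in> ball t r" "v \<in> ball t r" for u v
      proof -
        have "\<bar>u - t\<bar> = t - u" "\<bar>v - t\<bar> = v - t" using that by auto
        moreover from this have "\<bar>f u - f t - v0 * (u - t)\<bar> \<le> e * (t - u)"
          using r(2)[of u] that by (simp add: dist_real_def)
        moreover have "\<bar>f v - f t - v0 * (v - t)\<bar> \<le> e * (v - t)"
          using r(2)[of v] that by (simp add: dist_real_def abs_minus_commute)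
        ultimately have "f v - f u \<le> v0 * (v - u) + e * (v - u)"
          by (simp add: algebra_simps abs_le_iff)
        moreover have "v0 * (v - u) \<le> 0" using v0(1) that by (simp add: mult_nonpos_nonneg)
        ultimately show ?thesis by simp
      qed
      then show ?thesis using r(1) tZ by (intro exI[of _ r]) (auto simp: good_def)
    next
      case False
      then show ?thesis using tZ by (intro exI[of _ 1]) (auto simp: good_def)
    qed
  qed
  then obtain r where r: "\<And>t. 0 < r t" "\<And>t. good t (r t)" by metis
  have "gauge (\<lambda>t. ball t (r t))" using r(1) by (intro gaugeI) auto
  then obtain p where p: "p tagged_division_of {a..b}" "(\<lambda>t. ball t (r t)) fine p"
    using fine_division_exists_real by blast
  have fin: "finite p" using p(1) by blast
  have elem: "\<exists>u v. k = {u..v} \<and> u \<le> t \<and> t \<le> v \<and> k \<subseteq> ball t (r t) \<and> k \<subseteq> {a..b}" if tk: "(t, k) \<in> p" for t k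
  proof -
    obtain u v where "k = cbox u v" using tagged_division_ofD(4)[OF p(1) tk] by auto
    moreover have "t \<in> k" "k \<subseteq> {a..b}" using tagged_division_ofD(2,3)[OF p(1) tk] by auto
    moreover have "k \<subseteq> ball t (r t)" using p(2) tk by (auto simp: fine_def)
    ultimately show ?thesis by auto
  qed
  define bad where "bad = {(t, k) \<in> p. t \<in> Z}"
  have sub: "bad \<subseteq> p" by (auto simp: bad_def)
  have badfin: "finite bad" using fin sub finite_subset by blast
  have tp: "bad tagged_partial_division_of {a..b}"
    by (rule tagged_partial_division_subset[OF _ sub])
       (use p(1) in \<open>simp add: tagged_division_of_def\<close>)
  have div: "snd ` bad division_of \<Union>(snd ` bad)"
    by (rule division_of_tagged_division[OF tagged_partial_division_of_Union_self[OF tp]])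
  have inT: "\<Union>(snd ` bad) \<subseteq> T \<inter> {a..b}"
    using elem r(2) sub by (fastforce simp: bad_def good_def)
  have meas: "k \<in> lmeasurable" "measure lebesgue k = measure lborel k" "convex k"
    if k: "k \<in> snd ` bad" for k
    using division_ofD(4)[OF div k] by (auto simp: measure_completion)
  have "measure lebesgue (\<Union>(snd ` bad)) = (\<Sum>k\<in>snd ` bad. measure lebesgue k)"
  proof (rule measure_negligible_finite_Union)
    show "pairwise (\<lambda>S T. negligible (S \<inter> T)) (snd ` bad)"
    proof (rule pairwiseI)
      fix S T assume ST: "S \<in> snd ` bad" "T \<in> snd ` bad" "S \<noteq> T"
      then have "interior (S \<inter> T) = {}" using division_ofD(5)[OF div] by simp
      moreover have "convex (S \<inter> T)" using ST meas(3) by (intro convex_Int)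
      ultimately show "negligible (S \<inter> T)" by (simp add: negligible_convex_interior)
    qed
  qed (use badfin meas(1) in auto)
  then have "(\<Sum>k\<in>snd ` bad. measure lborel k) = measure lebesgue (\<Union>(snd ` bad))"
    using meas(2) by simp
  also have "\<dots> \<le> measure lebesgue T"
  proof (rule measure_mono_fmeasurable)
    show "T \<in> lmeasurable" by (rule Tl)
    show "\<Union>(snd ` bad) \<in> sets lebesgue"
      using badfin meas(1) by (intro sets.finite_Union) auto
  qed (use inT in blast)
  also have "\<dots> < d"
    using T_small d(1) by (simp add: emeasure_eq_measure2[OF Tl] ennreal_less_iff)
  finally have small: "(\<Sum>k\<in>snd ` bad. measure lborel k) < d" .
  have "f b - f a = (\<Sum>(t, k)\<in>p. f (Sup k) - f (Inf k))"
    using additive_tagged_division_1[OF \<open>a \<le> b\<close> p(1), of f] by simp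
  also have "\<dots> = (\<Sum>(t, k)\<in>p - bad. f (Sup k) - f (Inf k)) + (\<Sum>(t, k)\<in>bad. f (Sup k) - f (Inf k))"
    by (rule sum.subset_diff[OF sub fin])
  also have "(\<Sum>(t, k)\<in>p - bad. f (Sup k) - f (Inf k)) \<le> (\<Sum>(t, k)\<in>p - bad. e * (Sup k - Inf k))"
  proof (rule sum_mono, clarsimp)
    fix t k assume tk: "(t, k) \<in> p" "(t, k) \<notin> bad"
    then obtain u v where uv: "k = {u..v}" "u \<le> t" "t \<le> v" "k \<subseteq> ball t (r t)" "k \<subseteq> {a..b}"
      using elem by blast
    then have "t \<in> {a..b}" "t \<notin> Z" using tk by (auto simp: bad_def)
    moreover have "u \<in> k" "v \<in> k" using uv by auto
    then have "u \<in> ball t (r t)" "v \<in> ball t (r t)" using uv(4) by blast+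
    ultimately show "f (Sup k) - f (Inf k) \<le> e * (Sup k - Inf k)" using uv r(2)[of t] by (auto simp: good_def)
  qed
  also have "(\<Sum>(t, k)\<in>p - bad. e * (Sup k - Inf k)) \<le> (\<Sum>(t, k)\<in>p. e * (Sup k - Inf k))"
  proof (rule sum_mono2[OF fin Diff_subset])
    fix tk assume "tk \<in> p - (p - bad)"
    then obtain t k u v where "tk = (t, k)" "k = {u..v}" "u \<le> t" "t \<le> v"
      using elem by (metis DiffD1 surj_pair)
    then show "0 \<le> (case tk of (t, k) \<Rightarrow> e * (Sup k - Inf k))" using e(1) by simp
  qed
  also have "\<dots> = e * (b - a)"
    using additive_tagged_division_1[OF \<open>a \<le> b\<close> p(1), of "\<lambda>x. x"]
    by (simp add: sum_distrib_left[symmetric] split_def)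
  also have "(\<Sum>(t, k)\<in>bad. f (Sup k) - f (Inf k)) \<le> (\<Sum>(t, k)\<in>bad. norm (f (Sup k) - f (Inf k)))"
    by (intro sum_mono) auto
  \<comment> \<open>Two tags can share an interval only if its interior is empty, so the sum may run
    over intervals once the summand vanishes on such boxes; the \<open>if\<close> ensures this for
    the empty box.\<close>
  also have "\<dots> = (\<Sum>(t, k)\<in>bad. if k = {} then 0 else norm (f (Sup k) - f (Inf k)))"
    using division_ofD(3)[OF div] by (intro sum.cong) force+
  also have "\<dots> = (\<Sum>k\<in>snd ` bad. if k = {} then 0 else norm (f (Sup k) - f (Inf k)))"
    by (rule sum.over_tagged_division_lemma[OF tagged_partial_division_of_Union_self[OF tp]])
       (auto simp: not_less le_less)
  also have "\<dots> = (\<Sum>k\<in>snd ` bad. norm (f (Sup k) - f (Inf k)))"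
    using division_ofD(3)[OF div] by (intro sum.cong) auto
  also have "\<dots> < e" using d(2)[rule_format, of "snd ` bad"] div small inT by blast
  finally show "f b \<le> f a + e'" using e(2) by simp
qed

section \<open>Lyapunov functions of hybrid systems\<close>

text \<open>The integrating factor \<open>exp (c * t)\<close> turns the differential inequality into
  a derivative that is nonpositive almost everywhere.\<close>

lemma lyapunov_decay_along_flow:
  fixes V :: "'a::euclidean_space \<Rightarrow> real"
  assumes der: "\<And>x. (V has_derivative DV x) (at x)"
    and cont: "\<And>h. continuous_on UNIV (\<lambda>x. DV x h)"
    and ac: "abs_continuous_on {a..b} p" and "a \<le> b"
    and ae: "AE t in lebesgue. t \<in> {a<..<b} \<longrightarrow>
      (\<exists>v. (p has_vector_derivative v) (at t) \<and> DV (p t) v \<le> - c * V (p t))"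
  shows "V (p b) \<le> exp (- c * (b - a)) * V (p a)"
proof -
  define U where "U y = exp (c * fst y) * V (snd y)" for y :: "real \<times> 'a"
  define DU where "DU y h = exp (c * fst y) * DV (snd y) (snd h)
    + c * fst h * exp (c * fst y) * V (snd y)" for y h :: "real \<times> 'a"
  have dU: "(U has_derivative DU y) (at y)" for y
    unfolding U_def DU_def
    by (auto intro!: derivative_eq_intros has_derivative_compose[of snd, OF _ der])
  have contV: "continuous_on UNIV V"
    using der by (meson continuous_at_imp_continuous_on has_derivative_continuous)
  have "continuous_on UNIV (\<lambda>y. DU y h)" for h
    unfolding DU_def
    by (intro continuous_intros continuous_on_compose2[OF cont] continuous_on_compose2[OF contV]) auto
  then have acU: "abs_continuous_on {a..b} (\<lambda>t. U (t, p t))"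
    by (intro abs_continuous_on_C1_compose[OF dU] abs_continuous_on_Pair_ident[OF ac])
  have "\<exists>v\<le>0. ((\<lambda>t. U (t, p t)) has_real_derivative v) (at t)"
    if v: "(p has_vector_derivative v) (at t)" "DV (p t) v \<le> - c * V (p t)" for t v
  proof (intro exI conjI)
    have "((\<lambda>t. (t, p t)) has_derivative (\<lambda>s. (s, s *\<^sub>R v))) (at t)"
      using v(1) unfolding has_vector_derivative_def by (auto intro!: derivative_eq_intros)
    then have "((\<lambda>t. U (t, p t)) has_derivative (\<lambda>s. DU (t, p t) (s, s *\<^sub>R v))) (at t)"
      by (rule has_derivative_compose[OF _ dU])
    moreover have "DV (p t) (s *\<^sub>R v) = s * DV (p t) v" for s
      using has_derivative_linear[OF der] by (simp add: linear_cmul)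
    ultimately show "((\<lambda>t. U (t, p t)) has_real_derivative
        (exp (c * t) * (DV (p t) v + c * V (p t)))) (at t)"
      unfolding has_field_derivative_def
      by (elim has_derivative_eq_rhs) (auto simp: DU_def fun_eq_iff algebra_simps)
    show "exp (c * t) * (DV (p t) v + c * V (p t)) \<le> 0"
      using v(2) by (intro mult_nonneg_nonpos) auto
  qed
  then have aeU: "AE t in lebesgue. t \<in> {a<..<b} \<longrightarrow>
      (\<exists>v\<le>0. ((\<lambda>t. U (t, p t)) has_real_derivative v) (at t))"
    using ae by (rule_tac eventually_mono) blast+
  have "U (b, p b) \<le> U (a, p a)"
    by (rule nonincreasing_if_derivative_nonpos_AE[OF acU \<open>a \<le> b\<close> aeU])
  then have "exp (c * b) * V (p b) \<le> exp (c * a) * V (p a)" by (simp add: U_def)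
  then have "exp (- c * b) * (exp (c * b) * V (p b)) \<le> exp (- c * b) * (exp (c * a) * V (p a))"
    by (intro mult_left_mono) auto
  then show ?thesis
    unfolding mult.assoc[symmetric] exp_add[symmetric] by (simp add: algebra_simps)
qed

text \<open>Decay at rate \<open>0\<close> for the linear functions given by \<open>e\<close> and
  \<open>- e\<close> yields both inequalities.\<close>

lemma constant_along_flow:
  fixes p :: "real \<Rightarrow> 'a::euclidean_space"
  assumes ac: "abs_continuous_on {a..b} p" and "a \<le> b"
    and ae: "AE t in lebesgue. t \<in> {a<..<b} \<longrightarrow>
      (\<exists>v. (p has_vector_derivative v) (at t) \<and> v \<bullet> e = 0)"
  shows "p b \<bullet> e = p a \<bullet> e"
proof -
  have le: "p b \<bullet> e' \<le> p a \<bullet> e'" if e': "\<And>v. v \<bullet> e = 0 \<Longrightarrow> v \<bullet> e' = 0" for e'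
  proof -
    have "AE t in lebesgue. t \<in> {a<..<b} \<longrightarrow>
        (\<exists>v. (p has_vector_derivative v) (at t) \<and> v \<bullet> e' \<le> - 0 * (p t \<bullet> e'))"
      using ae by eventually_elim (use e' in auto)
    then have "p b \<bullet> e' \<le> exp (- 0 * (b - a)) * (p a \<bullet> e')"
      by (intro lyapunov_decay_along_flow[of "\<lambda>x. x \<bullet> e'" "\<lambda>_ h. h \<bullet> e'"] ac \<open>a \<le> b\<close>)
         (auto intro!: derivative_eq_intros)
    then show ?thesis by simp
  qed
  show ?thesis using le[of e] le[of "- e"] by simp
qed

text \<open>Flow decay is required of whole curves instead of derivatives of \<open>V\<close>,
  because the Lyapunov function will read the mode off the state and is smooth only while the mode
  stays fixed. Membership in the flow set is carried through the induction over jumps, as solutions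
  grant it at interior flow times only.\<close>

lemma hybrid_lyapunov_decay:
  assumes sol: "hybrid_solution H D p" and cl: "closed (flow_set H)"
    and JF: "jump_set H \<subseteq> flow_set H"
    and JM: "\<And>x y. \<lbrakk>x \<in> jump_set H; y \<in> jump_map H x\<rbrakk> \<Longrightarrow> y \<in> flow_set H"
    and flow: "\<And>a b q. \<lbrakk>a < b; abs_continuous_on {a..b} q; \<And>t. t \<in> {a..b} \<Longrightarrow> q t \<in> flow_set H;
      AE t in lebesgue. t \<in> {a<..<b} \<longrightarrow>
        (\<exists>v\<in>flow_map H (q t). (q has_vector_derivative v) (at t))\<rbrakk>
      \<Longrightarrow> V (q b) \<le> exp (- c * (b - a)) * V (q a)"
    and jump: "\<And>x y. \<lbrakk>x \<in> jump_set H; y \<in> jump_map H x\<rbrakk> \<Longrightarrow> V y \<le> exp (- c) * V x"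
    and TJ: "(T, J) \<in> D"
  shows "p T J \<in> flow_set H \<and> V (p T J) \<le> exp (- c * (T + real J)) * V (p 0 0)"
proof -
  define good where "good t j \<longleftrightarrow>
    p t j \<in> flow_set H \<and> V (p t j) \<le> exp (- c * (t + real j)) * V (p 0 0)" for t j
  have dom: "D \<subseteq> {0..} \<times> UNIV" "compact_hybrid_time_domain (D \<inter> ({0..T} \<times> {0..J}))"
    using sol TJ by (auto simp: hybrid_solution_def hybrid_time_domain_def)
  then obtain n t where t: "t 0 = 0" "\<And>j. j < n \<Longrightarrow> t j \<le> t (Suc j)"
    and eq: "D \<inter> ({0..T} \<times> {0..J}) = (\<Union>j<n. {t j..t (Suc j)} \<times> {j})"
    unfolding compact_hybrid_time_domain_def by blast
  have inD: "(r, j) \<in> D" if "j < n" "r \<in> {t j..t (Suc j)}" for r j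
    using eq that by blast
  have "(T, J) \<in> D \<inter> ({0..T} \<times> {0..J})" using TJ dom(1) by auto
  then have J: "J < n" "T \<in> {t J..t (Suc J)}" unfolding eq by auto
  have flow_step: "good r j"
    if j: "j < n" and start: "good (t j) j" and r: "r \<in> {t j..t (Suc j)}" for j r
  proof (cases "r = t j")
    \<comment> \<open>The excluded case \<open>r = t j\<close> includes intervals of length zero, on
      which a solution satisfies no flow condition.\<close>
    case False
    then have lt: "t j < r" using r by simp
    define q where "q = (\<lambda>r. p r j)"
    have sub: "{t j..r} \<subseteq> flow_times D j"
      using inD[OF j] r by (auto simp: flow_times_def)
    then have int: "{t j<..<r} \<subseteq> interior (flow_times D j)"
      by (intro interior_maximal) (auto simp: subset_iff)
    then have "interior (flow_times D j) \<noteq> {}" using lt by (metis dense greaterThanLessThan_iff subset_empty empty_iff)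
    then have lac: "locally_abs_continuous_on (flow_times D j) q"
      and inC: "\<And>s. s \<in> interior (flow_times D j) \<Longrightarrow> q s \<in> flow_set H"
      and ae: "AE s in lebesgue. s \<in> flow_times D j \<longrightarrow>
           (\<exists>v\<in>flow_map H (q s). (q has_vector_derivative v) (at s within flow_times D j))"
      using sol unfolding hybrid_solution_def q_def by blast+
    have ac: "abs_continuous_on {t j..r} q"
      using lac sub unfolding locally_abs_continuous_on_def by blast
    \<comment> \<open>Closedness and continuity extend the flow constraint to the end
      points.\<close>
    have "q ` closure {t j<..<r} \<subseteq> flow_set H"
      using lt inC int abs_continuous_on_imp_continuous_on[OF ac]
      by (intro image_closure_subset cl) auto
    then have C: "q s \<in> flow_set H" if "s \<in> {t j..r}" for s
      using that lt by auto
    have "AE s in lebesgue. s \<in> {t j<..<r} \<longrightarrow>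
        (\<exists>v\<in>flow_map H (q s). (q has_vector_derivative v) (at s))"
      using ae
    proof eventually_elim
      case (elim s)
      show ?case
      proof
        assume s: "s \<in> {t j<..<r}"
        then have "at s within flow_times D j = at s" "s \<in> flow_times D j"
          using int interior_subset by (blast intro: at_within_interior)+
        then show "\<exists>v\<in>flow_map H (q s). (q has_vector_derivative v) (at s)"
          using elim by simp
      qed
    qed
    with lt ac C have "V (q r) \<le> exp (- c * (r - t j)) * V (q (t j))" by (rule flow)
    also have "\<dots> \<le> exp (- c * (r - t j)) * (exp (- c * (t j + real j)) * V (p 0 0))"
      using start by (intro mult_left_mono) (auto simp: good_def q_def)
    also have "\<dots> = exp (- c * (r + real j)) * V (p 0 0)"
      unfolding mult.assoc[symmetric] exp_add[symmetric] by (simp add: algebra_simps)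
    finally show ?thesis using C[of r] lt by (simp add: good_def q_def)
  qed (use start in simp)
  have "good (t j) j" if "j \<le> J" for j
    using that
  proof (induction j)
    case 0
    have "closure (flow_set H) = flow_set H" using cl by simp
    then show ?case using sol JF t(1) by (auto simp: good_def hybrid_solution_def)
  next
    case (Suc j)
    then have j: "j < n" "Suc j < n" using J(1) by auto
    define s where "s = t (Suc j)"
    have "good s j" unfolding s_def using Suc j t(2) by (rule_tac flow_step[OF j(1)]) auto
    \<comment> \<open>\<open>s\<close> ends interval \<open>j\<close> and starts interval
      \<open>Suc j\<close>, which exists because \<open>Suc j \<le> J < n\<close>.\<close>
    have "(s, j) \<in> D" "(s, Suc j) \<in> D"
      using inD j t(2) by (auto simp: s_def)
    then have jm: "p s j \<in> jump_set H" "p s (Suc j) \<in> jump_map H (p s j)"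
      using sol unfolding hybrid_solution_def by auto
    have "V (p s (Suc j)) \<le> exp (- c) * V (p s j)" by (rule jump[OF jm])
    also have "\<dots> \<le> exp (- c) * (exp (- c * (s + real j)) * V (p 0 0))"
      using \<open>good s j\<close> by (intro mult_left_mono) (auto simp: good_def)
    also have "\<dots> = exp (- c * (s + real (Suc j))) * V (p 0 0)"
      unfolding mult.assoc[symmetric] exp_add[symmetric] by (simp add: algebra_simps)
    finally show ?case using JM[OF jm] by (simp add: good_def s_def)
  qed
  then have "good T J" using flow_step[OF J(1) _ J(2)] by simp
  then show ?thesis by (simp add: good_def)
qed

text \<open>Taking the square root of the decay estimate between the two quadratic bounds gives the
  gain \<open>sqrt (\<beta> / \<alpha>)\<close> and halves the rate.\<close>

lemma UGES_if_lyapunov: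
  assumes "compact \<A>" "\<A> \<subseteq> flow_set H \<union> jump_set H" and cl: "closed (flow_set H)"
    and JF: "jump_set H \<subseteq> flow_set H"
    and JM: "\<And>x y. \<lbrakk>x \<in> jump_set H; y \<in> jump_map H x\<rbrakk> \<Longrightarrow> y \<in> flow_set H"
    and flow: "\<And>a b q. \<lbrakk>a < b; abs_continuous_on {a..b} q; \<And>t. t \<in> {a..b} \<Longrightarrow> q t \<in> flow_set H;
      AE t in lebesgue. t \<in> {a<..<b} \<longrightarrow>
        (\<exists>v\<in>flow_map H (q t). (q has_vector_derivative v) (at t))\<rbrakk>
      \<Longrightarrow> V (q b) \<le> exp (- c * (b - a)) * V (q a)"
    and jump: "\<And>x y. \<lbrakk>x \<in> jump_set H; y \<in> jump_map H x\<rbrakk> \<Longrightarrow> V y \<le> exp (- c) * V x"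
    and lower: "\<And>x. x \<in> flow_set H \<Longrightarrow> \<alpha> * (infdist x \<A>)\<^sup>2 \<le> V x"
    and upper: "\<And>x. x \<in> flow_set H \<Longrightarrow> V x \<le> \<beta> * (infdist x \<A>)\<^sup>2"
    and pos: "0 < \<alpha>" "0 < \<beta>" "0 < c"
  shows "UGES H \<A>"
proof -
  have "infdist (p t j) \<A> \<le> sqrt (\<beta> / \<alpha>) * infdist (p 0 0) \<A> * exp (- (c / 2) * (t + real j))"
    if sol: "hybrid_solution H D p" and tj: "(t, j) \<in> D" for D p t j
  proof -
    have decay: "p T J \<in> flow_set H \<and> V (p T J) \<le> exp (- c * (T + real J)) * V (p 0 0)"
      if TJ: "(T, J) \<in> D" for T J
      by (rule hybrid_lyapunov_decay[where H = H and D = D and V = V and c = c])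
         (fact sol cl JF JM flow jump TJ)+
    have "(0, 0) \<in> D" using sol by (simp add: hybrid_solution_def)
    then have p0: "p 0 0 \<in> flow_set H" using decay by blast
    have p: "p t j \<in> flow_set H" "V (p t j) \<le> exp (- c * (t + real j)) * V (p 0 0)"
      using decay[OF tj] by blast+
    have "\<alpha> * (infdist (p t j) \<A>)\<^sup>2 \<le> exp (- c * (t + real j)) * (\<beta> * (infdist (p 0 0) \<A>)\<^sup>2)"
      by (intro order_trans[OF lower[OF p(1)]] order_trans[OF p(2)] mult_left_mono upper p0) simp
    also have "exp (- c * (t + real j)) = (exp (- (c / 2) * (t + real j)))\<^sup>2"
      by (simp add: power2_eq_square flip: exp_add)
    finally have "(infdist (p t j) \<A>)\<^sup>2
        \<le> (sqrt (\<beta> / \<alpha>) * infdist (p 0 0) \<A> * exp (- (c / 2) * (t + real j)))\<^sup>2"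
      using pos by (simp add: power_mult_distrib field_simps)
    then show ?thesis
      by (rule power2_le_imp_le) (use pos in \<open>simp add: infdist_nonneg\<close>)
  qed
  moreover have "0 < sqrt (\<beta> / \<alpha>)" "0 < c / 2" using pos by simp_all
  ultimately show ?thesis
    unfolding UGES_def using assms(1,2) by blast
qed

text \<open>There are no solutions, as an initial state would lie in an empty set; this covers an
  empty \<open>W\<close>.\<close>

lemma UGES_empty_system:
  assumes "flow_set H = {}" "jump_set H = {}"
  shows "UGES H {}"
  unfolding UGES_def using assms by (auto simp: hybrid_solution_def intro!: exI[of _ 1])

section \<open>Gradients and the Polyak-Lojasiewicz inequality\<close>

lemma gradient_eq:
  assumes "GDERIV f x :> D"
  shows "gradient f x = D"
  unfolding gradient_def
proof (rule the_equality, rule assms)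
  fix D' assume "GDERIV f x :> D'"
  then have "(\<lambda>h. h \<bullet> D') = (\<lambda>h. h \<bullet> D)"
    using assms unfolding gderiv_def by (rule has_derivative_unique)
  then show "D' = D" by (metis inner_commute vector_eq_rdot)
qed

lemma cont_differentiable_GDERIV:
  "cont_differentiable f \<Longrightarrow> GDERIV f x :> gradient f x"
  unfolding cont_differentiable_def by (metis gradient_eq)

lemma GDERIV_minimum:
  assumes "GDERIV f x :> D" "\<And>y. f x \<le> f y"
  shows "D = 0"
proof -
  have "(\<lambda>h. h \<bullet> D) = (\<lambda>h. 0)"
    using assms by (intro has_derivative_local_min[of f _ x]) (auto simp: gderiv_def)
  then show ?thesis by (metis inner_eq_zero_iff)
qed

text \<open>If the bound failed at \<open>u\<close>, then \<open>v \<mapsto> sqrt (f v - f a) + c * norm (v - u)\<close> with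
  \<open>c\<close> slightly below \<open>sqrt (\<mu> / 2)\<close> would attain its minimum away from \<open>a\<close>, at a point where
  the gradient of the square root has norm at most \<open>c\<close>.\<close>

lemma quadratic_growth:
  fixes f :: "'a::euclidean_space \<Rightarrow> real"
  assumes grad: "\<And>u. GDERIV f u :> g u"
    and least: "\<And>u. f a \<le> f u" and unique: "\<And>u. f u = f a \<Longrightarrow> u = a"
    and "\<mu> > 0" and PL: "\<And>u. \<mu> * (f u - f a) \<le> (norm (g u))\<^sup>2 / 2"
  shows "\<mu> / 2 * (norm (u - a))\<^sup>2 \<le> f u - f a"
proof (rule ccontr)
  assume "\<not> ?thesis"
  then have less: "f u - f a < \<mu> / 2 * (norm (u - a))\<^sup>2" by simp
  then have "u \<noteq> a" by auto
  then have n: "0 < norm (u - a)" by simp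
  define r where "r v = sqrt (f v - f a)" for v
  have "r u < sqrt (\<mu> / 2 * (norm (u - a))\<^sup>2)"
    unfolding r_def using less by (rule real_sqrt_less_mono)
  then have "r u / norm (u - a) < sqrt (\<mu> / 2)"
    using n by (simp only: real_sqrt_mult divide_less_eq) simp
  then obtain c where c: "r u / norm (u - a) < c" "c < sqrt (\<mu> / 2)"
    using dense by blast
  have rnn: "0 \<le> r v" for v using least by (simp add: r_def)
  have c0: "0 < c" using c(1) rnn[of u] n by (meson divide_nonneg_pos le_less_trans)
  have cu: "r u < c * norm (u - a)" using c(1) n by (simp add: divide_less_eq)
  have contf: "continuous_on UNIV f"
    using grad unfolding gderiv_def
    by (meson continuous_at_imp_continuous_on has_derivative_continuous)
  define \<phi> where "\<phi> v = r v + c * norm (v - u)" for v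
  have "continuous_on (cball u (norm (u - a))) \<phi>"
    unfolding \<phi>_def r_def by (intro continuous_intros continuous_on_subset[OF contf]) simp
  then have "\<exists>b\<in>cball u (norm (u - a)). \<forall>v\<in>cball u (norm (u - a)). \<phi> b \<le> \<phi> v"
    by (intro continuous_attains_inf) auto
  then obtain b where b: "\<And>v. v \<in> cball u (norm (u - a)) \<Longrightarrow> \<phi> b \<le> \<phi> v"
    by blast
  \<comment> \<open>Outside the ball the penalty alone exceeds \<open>r u = \<phi> u\<close>, so the
    minimum over the ball is global.\<close>
  have bmin: "\<phi> b \<le> \<phi> v" for v
  proof (cases "v \<in> cball u (norm (u - a))")
    case False
    then have "c * norm (u - a) \<le> c * norm (v - u)"
      using c0 by (simp add: dist_norm norm_minus_commute)
    then have "\<phi> u \<le> \<phi> v" using cu rnn[of v] by (simp add: \<phi>_def)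
    then show ?thesis using b[of u] by simp
  qed (rule b)
  \<comment> \<open>\<open>\<phi> a = c * norm (u - a)\<close> exceeds \<open>\<phi> u\<close>.
    Hence \<open>r b > 0\<close>, and the square root is differentiable at \<open>b\<close>.\<close>
  have "b \<noteq> a"
    using bmin[of u] cu by (auto simp: \<phi>_def r_def norm_minus_commute)
  then have fb: "f a < f b" using least[of b] unique[of b] by fastforce
  then have rb: "0 < r b" "(r b)\<^sup>2 = f b - f a" by (simp_all add: r_def)
  define h where "h = g b"
  \<comment> \<open>Along the descent direction \<open>- h\<close> the penalty, not differentiable
    at \<open>u\<close>, is replaced by the bound from the triangle inequality. So
    \<open>\<psi>\<close> has a derivative at \<open>0\<close>, and \<open>0\<close> is its minimum
    over \<open>t \<ge> 0\<close>.\<close>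
  define \<psi> where "\<psi> t = r (b - t *\<^sub>R h) + c * t * norm h" for t
  have "((\<lambda>t. f (b - t *\<^sub>R h)) has_derivative (\<lambda>t. (- (t *\<^sub>R h)) \<bullet> h)) (at 0)"
  proof -
    have "(f has_derivative (\<lambda>v. v \<bullet> h)) (at (b - 0 *\<^sub>R h))"
      using grad[of b] by (simp add: gderiv_def h_def)
    moreover have "((\<lambda>t. b - t *\<^sub>R h) has_derivative (\<lambda>t. - (t *\<^sub>R h))) (at 0)"
      by (auto intro!: derivative_eq_intros)
    ultimately show ?thesis by (rule has_derivative_compose[rotated])
  qed
  then have "((\<lambda>t. f (b - t *\<^sub>R h)) has_real_derivative (- (norm h)\<^sup>2)) (at 0)"
    unfolding has_field_derivative_def
    by (rule has_derivative_eq_rhs) (auto simp: fun_eq_iff power2_norm_eq_inner)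
  then have "(\<psi> has_real_derivative (- (norm h)\<^sup>2 / (2 * r b) + c * norm h)) (at 0)"
    unfolding \<psi>_def r_def using fb
    by (auto intro!: derivative_eq_intros simp: divide_simps)
  moreover have "\<psi> 0 \<le> \<psi> t" if "0 \<le> t" for t
  proof -
    have "norm (b - t *\<^sub>R h - u) \<le> norm (b - u) + t * norm h"
      using norm_triangle_ineq4[of "b - u" "t *\<^sub>R h"] that by (simp add: algebra_simps)
    then have "c * norm (b - t *\<^sub>R h - u) \<le> c * (norm (b - u) + t * norm h)"
      using c0 by simp
    then show ?thesis
      using bmin[of "b - t *\<^sub>R h"] by (simp add: \<phi>_def \<psi>_def algebra_simps)
  qed
  ultimately have "0 \<le> - (norm h)\<^sup>2 / (2 * r b) + c * norm h"
    using DERIV_neg_dec_right[of \<psi> _ 0] by (smt (verit, best) field_sum_of_halves half_gt_zero)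
  then have "(norm h)\<^sup>2 \<le> 2 * r b * c * norm h"
    using rb(1) by (simp add: field_simps)
  moreover have h2: "2 * \<mu> * (r b)\<^sup>2 \<le> (norm h)\<^sup>2"
    using PL[of b] by (simp add: rb(2) h_def)
  moreover have "0 < 2 * \<mu> * (r b)\<^sup>2" using \<open>\<mu> > 0\<close> rb(1) by simp
  ultimately have "norm h \<le> 2 * r b * c"
    by (cases "h = 0") (auto simp: power2_eq_square)
  then have "(norm h)\<^sup>2 \<le> (2 * r b * c)\<^sup>2" by (intro power_mono) auto
  then have "2 * \<mu> * (r b)\<^sup>2 \<le> 4 * c\<^sup>2 * (r b)\<^sup>2"
    using h2 by (simp add: power_mult_distrib mult_ac)
  then have "2 * \<mu> \<le> 4 * c\<^sup>2" using rb(1) by simp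
  moreover have "c\<^sup>2 < \<mu> / 2"
    using c(2) c0 \<open>\<mu> > 0\<close> by (metis abs_of_pos real_sqrt_abs real_sqrt_less_iff)
  ultimately show False by simp
qed

text \<open>Quadratic growth chained with the Polyak-Lojasiewicz inequality. It converts the size of
  a gradient into a distance to the minimizer, as strong monotonicity would.\<close>

lemma PL_gradient_growth:
  fixes f :: "'a::euclidean_space \<Rightarrow> real"
  assumes grad: "\<And>u. GDERIV f u :> g u"
    and least: "\<And>u. f a \<le> f u" and unique: "\<And>u. f u = f a \<Longrightarrow> u = a"
    and "\<mu> > 0" and PL: "\<And>u. \<mu> * (f u - f a) \<le> (norm (g u))\<^sup>2 / 2"
  shows "\<mu> * norm (u - a) \<le> norm (g u)"
proof (rule power2_le_imp_le)
  have "\<mu> * (\<mu> / 2 * (norm (u - a))\<^sup>2) \<le> \<mu> * (f u - f a)"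
    using quadratic_growth[OF grad least unique \<open>\<mu> > 0\<close> PL] \<open>\<mu> > 0\<close>
    by (intro mult_left_mono) auto
  then show "(\<mu> * norm (u - a))\<^sup>2 \<le> (norm (g u))\<^sup>2"
    using PL[of u] by (simp add: power_mult_distrib power2_eq_square mult_ac)
qed simp

text \<open>At unit distance from the minimizer the gradient has norm at least \<open>\<mu>\<close>
  by growth and at most \<open>L\<close> because it vanishes at the minimizer.\<close>

lemma PL_constant_le_lipschitz:
  fixes f :: "'a::euclidean_space \<Rightarrow> real"
  assumes grad: "\<And>u. GDERIV f u :> g u" and lip: "L-lipschitz_on UNIV g"
    and least: "\<And>u. f a \<le> f u" and unique: "\<And>u. f u = f a \<Longrightarrow> u = a"
    and "\<mu> > 0" and PL: "\<And>u. \<mu> * (f u - f a) \<le> (norm (g u))\<^sup>2 / 2"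
  shows "\<mu> \<le> L"
proof -
  obtain e :: 'a where e: "norm e = 1" using vector_choose_size[of 1] by auto
  have "g a = 0" by (rule GDERIV_minimum[OF grad least])
  then have "norm (g (a + e)) \<le> L"
    using lipschitz_onD[OF lip, of "a + e" a] e by (simp add: dist_norm)
  with PL_gradient_growth[OF grad least unique \<open>\<mu> > 0\<close> PL, of "a + e"] e show ?thesis by simp
qed

lemma GDERIV_add_affine_compose:
  fixes G :: "real^'m^'p"
  assumes "GDERIV fu u :> du" "GDERIV fy (G *v u + d) :> dy"
  shows "GDERIV (\<lambda>u. fu u + fy (G *v u + d)) u :> du + transpose G *v dy"
proof -
  have "((\<lambda>u. G *v u + d) has_derivative (\<lambda>h. G *v h)) (at u)"
    by (auto intro!: derivative_eq_intros bounded_linear.has_derivative[OF matrix_vector_mul_bounded_linear])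
  then have "((\<lambda>u. fy (G *v u + d)) has_derivative (\<lambda>h. (G *v h) \<bullet> dy)) (at u)"
    by (rule has_derivative_compose) (use assms(2) in \<open>simp add: gderiv_def\<close>)
  then have "((\<lambda>u. fu u + fy (G *v u + d)) has_derivative (\<lambda>h. h \<bullet> du + (G *v h) \<bullet> dy)) (at u)"
    using assms(1) unfolding gderiv_def by (intro has_derivative_add)
  moreover have "(G *v h) \<bullet> dy = h \<bullet> (transpose G *v dy)" for h
    using inner_transpose_mult[of G dy h] by (simp only: inner_commute)
  ultimately show ?thesis by (simp only: gderiv_def inner_add_right)
qed

lemma norm_transpose_mult_lipschitz:
  fixes G :: "real^'m^'p" and \<phi> :: "real^'p \<Rightarrow> real^'p"
  assumes "L-lipschitz_on UNIV \<phi>"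
  shows "norm (transpose G *v \<phi> y - transpose G *v \<phi> y') \<le> spectral_norm G * (L * norm (y - y'))"
proof -
  have "norm (transpose G *v \<phi> y - transpose G *v \<phi> y') \<le> spectral_norm G * norm (\<phi> y - \<phi> y')"
    by (metis matrix_vector_mult_diff_distrib norm_transpose_mult_le_spectral_norm)
  also have "\<dots> \<le> spectral_norm G * (L * norm (y - y'))"
    using lipschitz_onD[OF assms, of y y']
    by (intro mult_left_mono spectral_norm_nonneg) (simp add: dist_norm)
  finally show ?thesis .
qed

text \<open>The gains may be zero, for instance if \<open>C\<close> or \<open>G\<close> is, but the
  weight \<open>k / (2 * b)\<close> needs positive ones; the strict inequality leaves room to
  enlarge them.\<close>

lemma perturb_to_positive:
  fixes k b c d :: real
  assumes "0 \<le> k" "0 \<le> b" "c * k * b < d"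
  obtains k' b' where "k \<le> k'" "b \<le> b'" "0 < k'" "0 < b'" "c * k' * b' < d"
proof -
  have "((\<lambda>\<eta>. c * (k + \<eta>) * (b + \<eta>)) \<longlongrightarrow> c * (k + 0) * (b + 0)) (at_right 0)"
    by (intro tendsto_intros)
  then have "eventually (\<lambda>\<eta>. c * (k + \<eta>) * (b + \<eta>) < d) (at_right 0)"
    using assms(3) by (intro order_tendstoD(2)) auto
  moreover have "eventually (\<lambda>\<eta>. 0 < \<eta>) (at_right (0::real))"
    by (simp add: eventually_at_right_less)
  ultimately obtain \<eta> where "c * (k + \<eta>) * (b + \<eta>) < d" "0 < \<eta>"
    using eventually_happens[OF eventually_conj] by (metis (mono_tags, lifting) trivial_limit_at_right_real)
  then show ?thesis using assms(1,2) by (intro that[of "k + \<eta>" "b + \<eta>"]) auto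
qed

text \<open>Completing the square with \<open>y = k * \<zeta>\<close>: the weight \<open>k / (2 * b)\<close> makes the quadratic form
  in \<open>(y, g)\<close> equal to \<open>- \<epsilon> * (g\<^sup>2 - (1 + s) * y * g + (2 * E - 1) * s * y\<^sup>2)\<close> at the critical value
  \<open>\<rho> * m = 4 * E * \<epsilon> * k * b\<close>, and this is at most \<open>- \<epsilon> * (g - s * y)\<^sup>2\<close>.\<close>

lemma interconnection_decay:
  fixes k b E \<epsilon> m \<mu> \<rho> :: real
  assumes pos: "0 < k" "0 < b" "1 \<le> E" "0 < \<epsilon>" "0 < m" "0 < \<mu>" and gap: "4 * E * \<epsilon> * k * b < \<rho> * m"
  obtains c where "0 < c"
    "\<And>s \<zeta> g Q q. \<lbrakk>1 \<le> s; s \<le> E; 0 \<le> \<zeta>; 0 \<le> g; m * \<zeta>\<^sup>2 \<le> Q; q \<le> g\<^sup>2 / (2 * \<mu>)\<rbrakk> \<Longrightarrow>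
      k / (2 * b) * s * (- \<rho> * Q + 2 * b * \<epsilon> * \<zeta> * (g + k * \<zeta>)) - \<epsilon> * g\<^sup>2 + \<epsilon> * k * \<zeta> * g
        \<le> - c * (k / (2 * b) * s * Q + q)"
proof -
  define d where "d = \<rho> * m - 4 * E * \<epsilon> * k * b"
  define \<gamma> where "\<gamma> = k / (2 * b)"
  \<comment> \<open>The first bound spends half of the surplus \<open>d\<close> on the decay of
    \<open>Q\<close>; the other half survives as \<open>\<gamma> * d / 2 * \<zeta>\<^sup>2\<close>.
    The remaining bounds let the completed square and this remainder absorb
    \<open>c * q\<close>.\<close>
  define c where "c = Min {d / (2 * m), \<epsilon> * \<mu>, \<gamma> * d * \<mu> / (2 * E\<^sup>2 * k\<^sup>2)}"
  have d: "0 < d" using gap by (simp add: d_def)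
  have \<gamma>: "0 < \<gamma>" "\<gamma> * (2 * b) = k" using pos by (simp_all add: \<gamma>_def)
  have c: "0 < c" using pos d \<gamma> by (simp add: c_def)
  have "c \<le> d / (2 * m)" "c \<le> \<epsilon> * \<mu>" and c3: "c \<le> \<gamma> * d * \<mu> / (2 * E\<^sup>2 * k\<^sup>2)"
    by (simp_all add: c_def)
  then have c12: "c \<le> d / (2 * m)" "c / \<mu> \<le> \<epsilon>" using pos by (simp_all add: divide_le_eq)
  have "0 < 2 * E\<^sup>2 * k\<^sup>2" using pos by simp
  then have "c * (2 * E\<^sup>2 * k\<^sup>2) \<le> \<gamma> * d * \<mu>" using c3 by (simp add: le_divide_eq)
  then have c3: "c / \<mu> * (E\<^sup>2 * k\<^sup>2) \<le> \<gamma> * d / 2" using pos by (simp add: field_simps)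
  have "\<gamma> * s * (- \<rho> * Q + 2 * b * \<epsilon> * \<zeta> * (g + k * \<zeta>)) - \<epsilon> * g\<^sup>2 + \<epsilon> * k * \<zeta> * g
      \<le> - c * (\<gamma> * s * Q + q)"
    if A: "1 \<le> s" "s \<le> E" "0 \<le> \<zeta>" "0 \<le> g" "m * \<zeta>\<^sup>2 \<le> Q" "q \<le> g\<^sup>2 / (2 * \<mu>)" for s \<zeta> g Q q
  proof -
    define y where "y = k * \<zeta>"
    have y: "0 \<le> y" using pos A by (simp add: y_def)
    have Q0: "0 \<le> Q" using order_trans[OF _ A(5)] pos by simp
    have "(\<rho> - d / (2 * m)) * m = 4 * E * \<epsilon> * k * b + d / 2"
      using pos by (simp add: d_def field_simps)
    then have rd: "(\<rho> - d / (2 * m)) * (m * \<zeta>\<^sup>2) = (4 * E * \<epsilon> * k * b + d / 2) * \<zeta>\<^sup>2"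
      by (metis mult.assoc)
    have "0 < (\<rho> - d / (2 * m)) * m"
      unfolding \<open>(\<rho> - d / (2 * m)) * m = 4 * E * \<epsilon> * k * b + d / 2\<close>
      using pos d by (intro add_nonneg_pos) auto
    then have "0 \<le> \<rho> - d / (2 * m)" using pos by (simp add: zero_less_mult_iff)
    then have "(\<rho> - d / (2 * m)) * (m * \<zeta>\<^sup>2) \<le> (\<rho> - d / (2 * m)) * Q"
      by (rule mult_left_mono[OF A(5)])
    moreover have "c * Q \<le> d / (2 * m) * Q" by (rule mult_right_mono[OF c12(1) Q0])
    ultimately have "(4 * E * \<epsilon> * k * b + d / 2) * \<zeta>\<^sup>2 + c * Q \<le> \<rho> * Q"
      unfolding rd by (simp add: algebra_simps)
    then have "\<gamma> * s * ((4 * E * \<epsilon> * k * b + d / 2) * \<zeta>\<^sup>2 + c * Q) \<le> \<gamma> * s * (\<rho> * Q)"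
      using \<gamma>(1) A(1) by (intro mult_left_mono) auto
    then have "\<gamma> * s * (4 * E * \<epsilon> * k * b * \<zeta>\<^sup>2) + \<gamma> * s * (d / 2 * \<zeta>\<^sup>2) + c * (\<gamma> * s * Q)
        \<le> \<gamma> * s * (\<rho> * Q)"
      by (simp only: ring_distribs mult_ac)
    moreover have "\<gamma> * s * (4 * E * \<epsilon> * k * b * \<zeta>\<^sup>2) = \<epsilon> * (2 * E * s * y\<^sup>2)"
    proof -
      have "\<gamma> * s * (4 * E * \<epsilon> * k * b * \<zeta>\<^sup>2) = (\<gamma> * (2 * b)) * (s * 2 * E * \<epsilon> * k * \<zeta>\<^sup>2)"
        by (simp add: algebra_simps)
      then show ?thesis unfolding \<gamma>(2) y_def by (simp add: power2_eq_square algebra_simps)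
    qed
    moreover have "\<gamma> * s * (2 * b * \<epsilon> * \<zeta> * (g + k * \<zeta>)) = \<epsilon> * (s * y * (g + y))"
    proof -
      have "\<gamma> * s * (2 * b * \<epsilon> * \<zeta> * (g + k * \<zeta>)) = (\<gamma> * (2 * b)) * (s * \<epsilon> * \<zeta> * (g + k * \<zeta>))"
        by (simp add: algebra_simps)
      then show ?thesis unfolding \<gamma>(2) y_def by (simp add: algebra_simps)
    qed
    moreover have "\<gamma> * d / 2 * \<zeta>\<^sup>2 \<le> \<gamma> * s * (d / 2 * \<zeta>\<^sup>2)"
      using mult_right_mono[OF A(1), of "\<gamma> * (d / 2 * \<zeta>\<^sup>2)"] \<gamma>(1) d by (simp add: algebra_simps)
    ultimately have 1: "\<gamma> * s * (- \<rho> * Q + 2 * b * \<epsilon> * \<zeta> * (g + k * \<zeta>)) + c * (\<gamma> * s * Q)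
        \<le> \<epsilon> * (s * y * (g + y) - 2 * E * s * y\<^sup>2) - \<gamma> * d / 2 * \<zeta>\<^sup>2"
      unfolding right_diff_distrib
      by (simp only: distrib_left mult_minus_left mult_minus_right)
    have "0 \<le> (s - 1) * (y * g)" using A y by simp
    moreover have "s * s \<le> (2 * E - 1) * s" using A pos by (intro mult_right_mono) linarith+
    then have "s * s * y\<^sup>2 \<le> (2 * E - 1) * s * y\<^sup>2" by (rule mult_right_mono) simp
    ultimately have "s * y * (g + y) - 2 * E * s * y\<^sup>2 - g\<^sup>2 + y * g \<le> - (g - s * y)\<^sup>2"
      by (simp add: power2_eq_square algebra_simps)
    then have 2: "\<epsilon> * (s * y * (g + y) - 2 * E * s * y\<^sup>2 - g\<^sup>2 + y * g) \<le> \<epsilon> * - (g - s * y)\<^sup>2"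
      using pos by (intro mult_left_mono) auto
    \<comment> \<open>The completed square vanishes at \<open>g = s * y\<close>, so it controls
      \<open>g\<^sup>2\<close> only up to \<open>(s * y)\<^sup>2\<close>; the reserved multiple of
      \<open>\<zeta>\<^sup>2\<close> pays for that.\<close>
    have "g\<^sup>2 / 2 \<le> (g - s * y)\<^sup>2 + (s * y)\<^sup>2"
      using zero_le_power2[of "g - 2 * (s * y)"] by (simp add: power2_eq_square algebra_simps)
    moreover have "(s * y)\<^sup>2 \<le> (E * y)\<^sup>2"
      using A y by (intro power_mono mult_right_mono) auto
    ultimately have "g\<^sup>2 / 2 \<le> (g - s * y)\<^sup>2 + E\<^sup>2 * k\<^sup>2 * \<zeta>\<^sup>2"
      by (simp add: y_def power_mult_distrib mult.assoc)
    then have "c / \<mu> * (g\<^sup>2 / 2) \<le> c / \<mu> * ((g - s * y)\<^sup>2 + E\<^sup>2 * k\<^sup>2 * \<zeta>\<^sup>2)"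
      using c pos by (intro mult_left_mono) auto
    also have "\<dots> = c / \<mu> * (g - s * y)\<^sup>2 + c / \<mu> * (E\<^sup>2 * k\<^sup>2) * \<zeta>\<^sup>2"
      by (simp add: algebra_simps)
    also have "\<dots> \<le> \<epsilon> * (g - s * y)\<^sup>2 + \<gamma> * d / 2 * \<zeta>\<^sup>2"
      by (intro add_mono mult_right_mono c12 c3) auto
    finally have "c / \<mu> * (g\<^sup>2 / 2) \<le> \<epsilon> * (g - s * y)\<^sup>2 + \<gamma> * d / 2 * \<zeta>\<^sup>2" .
    moreover have "c * q \<le> c * (g\<^sup>2 / (2 * \<mu>))" using c A by (intro mult_left_mono) auto
    ultimately have 3: "c * q \<le> \<epsilon> * (g - s * y)\<^sup>2 + \<gamma> * d / 2 * \<zeta>\<^sup>2" by (simp add: mult.commute)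
    show ?thesis using 1 2 3 by (simp add: y_def algebra_simps)
  qed
  then show ?thesis using that c unfolding \<gamma>_def by blast
qed

text \<open>A quotient with denominator \<open>0\<close> is \<open>\<infinity>\<close> in the extended reals, so the strict inequality then
  carries no information; its multiplied-out form remains true.\<close>

lemma ereal_less_divide_imp_mult_less:
  fixes x y z :: real
  assumes "ereal x < ereal y / ereal z" "0 < y" "0 \<le> z"
  shows "x * z < y"
proof (cases "z = 0")
  case False
  then have "x < y / z" using assms(1) by simp
  then show ?thesis using False assms(3) by (simp add: less_divide_eq)
qed (use assms in simp)

section \<open>Lyapunov function of the attacked system\<close>

text \<open>\<open>Q i\<close> is the matrix of the quadratic Lyapunov function in mode \<open>i\<close>, \<open>q w\<close> the suboptimality
  gap with gradient \<open>g w\<close>, and \<open>deviation x u w\<close> is \<open>x - x\<^sup>*(u, w)\<close>.  The weights \<open>a\<close> and \<open>c\<close> of the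
  two timers compensate jumps and attack phases, and \<open>\<delta>\<close> is the decay rate of the interconnection.\<close>

locale attacked_interconnection =
  fixes A :: "nat \<Rightarrow> real^'n^'n" and B :: "nat \<Rightarrow> real^'m^'n" and E :: "nat \<Rightarrow> real^'q^'n"
    and C :: "real^'n^'p" and G :: "real^'m^'p"
    and fu :: "real^'m \<Rightarrow> real" and fy :: "real^'p \<Rightarrow> real"
    and s :: nat and Sa :: "nat set" and W :: "(real^'q) set"
    and N0 :: nat and T0 \<kappa>1 \<kappa>2 \<epsilon> :: real
    and X :: "real^'m^'n" and Y :: "real^'q^'n" and Q :: "nat \<Rightarrow> real^'n^'n"
    and q :: "real^'q \<Rightarrow> real^'m \<Rightarrow> real" and g :: "real^'q \<Rightarrow> real^'m \<Rightarrow> real^'m"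
    and ustar :: "real^'q \<Rightarrow> real^'m" and rate :: "nat \<Rightarrow> real"
    and k b m M \<mu> l Lu a c \<rho> \<delta> \<Theta> :: real
  assumes W: "compact W" "W \<noteq> {}" and Sa: "finite Sa"
    and nonneg: "0 \<le> T0" "0 \<le> \<kappa>1" "0 < \<epsilon>" "0 \<le> a" "0 \<le> c"
    and pos: "0 < k" "0 < b" "0 < m" "0 < M" "0 < \<mu>" "0 < \<delta>"
    and equilibrium: "\<And>i u w. \<lbrakk>i \<in> insert s Sa; w \<in> W\<rbrakk>
      \<Longrightarrow> A i *v (- (X *v u) - Y *v w) + B i *v u + E i *v w = 0"
    and controller: "\<And>x u w. w \<in> W \<Longrightarrow>
      norm (gradient fu u + transpose G *v gradient fy (C *v x) - g w u)
        \<le> k * norm (x + X *v u + Y *v w)"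
    and grad: "\<And>w u. GDERIV (q w) u :> g w u" and grad_cont: "\<And>w. continuous_on UNIV (g w)"
    and q_upper: "\<And>w u. w \<in> W \<Longrightarrow> q w u \<le> (norm (g w u))\<^sup>2 / (2 * \<mu>)"
    and q_lower: "\<And>w u. w \<in> W \<Longrightarrow> \<mu> / 2 * (norm (u - ustar w))\<^sup>2 \<le> q w u"
    and grad_upper: "\<And>w u. w \<in> W \<Longrightarrow> norm (g w u) \<le> l * norm (u - ustar w)"
    and ustar_lipschitz: "Lu-lipschitz_on W ustar"
    and Q_sym: "\<And>i. transpose (Q i) = Q i"
    and Q_lower: "\<And>i z. m * (norm z)\<^sup>2 \<le> z \<bullet> (Q i *v z)"
    and Q_upper: "\<And>i z. z \<bullet> (Q i *v z) \<le> M * (norm z)\<^sup>2"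
    and Q_coupling: "\<And>i z v. (Q i *v z) \<bullet> (X *v v) \<le> b * norm z * norm v"
    and Q_rate: "\<And>i z. i \<in> insert s Sa \<Longrightarrow> 2 * ((Q i *v z) \<bullet> (A i *v z)) \<le> rate i * (z \<bullet> (Q i *v z))"
    and Q_jump: "\<And>i j z. z \<bullet> (Q j *v z) \<le> exp a * (z \<bullet> (Q i *v z))"
    and rate: "\<And>i. i \<in> insert s Sa \<Longrightarrow> a * \<kappa>1 + c * (\<kappa>2 - indicator Sa i) + rate i \<le> - \<rho>"
    and \<Theta>: "exp (a * N0 + c * T0) \<le> \<Theta>"
    and decay: "\<And>t \<zeta> y S r. \<lbrakk>1 \<le> t; t \<le> \<Theta>; 0 \<le> \<zeta>; 0 \<le> y; m * \<zeta>\<^sup>2 \<le> S; r \<le> y\<^sup>2 / (2 * \<mu>)\<rbrakk> \<Longrightarrow>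
      k / (2 * b) * t * (- \<rho> * S + 2 * b * \<epsilon> * \<zeta> * (y + k * \<zeta>)) - \<epsilon> * y\<^sup>2 + \<epsilon> * k * \<zeta> * y
        \<le> - \<delta> * (k / (2 * b) * t * S + r)"
begin

abbreviation sys :: "('n, 'm, 'q) state hybrid_system" where
  "sys \<equiv> attacked_system A B E C G fu fy s Sa W (\<lambda>_. 0) N0 T0 \<kappa>1 \<kappa>2 \<epsilon>"

definition deviation :: "real^'n \<Rightarrow> real^'m \<Rightarrow> real^'q \<Rightarrow> real^'n" where
  "deviation x u w = x + X *v u + Y *v w"

text \<open>Balances the two rates: \<open>exp (\<eta> * \<tau>1)\<close> costs at most
  \<open>\<eta> * \<kappa>1\<close> of \<open>\<delta>\<close> along flows, leaving
  \<open>\<eta>\<close>, and gains \<open>\<eta>\<close> at each jump.\<close>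

definition \<eta> :: real where "\<eta> = \<delta> / (1 + \<kappa>1)"

definition \<gamma> :: real where "\<gamma> = k / (2 * b)"

definition form :: "nat \<Rightarrow> real^'n \<Rightarrow> real" where "form i z = z \<bullet> (Q i *v z)"

definition energy :: "nat \<Rightarrow> real^'q \<Rightarrow> real^'n \<Rightarrow> real^'m \<Rightarrow> real \<Rightarrow> real \<Rightarrow> real" where
  "energy i w x u \<tau>1 \<tau>2
    = \<gamma> * exp (a * \<tau>1 + c * \<tau>2) * form i (deviation x u w) + q w u"

text \<open>Mode and disturbance enter as parameters and the corresponding state components are
  ignored, which makes the function C1 on the whole space.\<close>

definition lyap :: "nat \<Rightarrow> real^'q \<Rightarrow> ('n, 'm, 'q) state \<Rightarrow> real" where
  "lyap i w = (\<lambda>(x, u, \<tau>1, \<tau>2, _, _). exp (\<eta> * \<tau>1) * energy i w x u \<tau>1 \<tau>2)"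

definition dlyap :: "nat \<Rightarrow> real^'q \<Rightarrow> ('n, 'm, 'q) state \<Rightarrow> ('n, 'm, 'q) state \<Rightarrow> real" where
  "dlyap i w = (\<lambda>(x, u, \<tau>1, \<tau>2, _, _) (hx, hu, h1, h2, _, _).
     exp (\<eta> * \<tau>1) * (\<gamma> * exp (a * \<tau>1 + c * \<tau>2) *
         (2 * ((Q i *v deviation x u w) \<bullet> (hx + X *v hu)) + (a * h1 + c * h2) * form i (deviation x u w))
       + hu \<bullet> g w u + \<eta> * h1 * energy i w x u \<tau>1 \<tau>2))"

lemma \<gamma>_pos: "0 < \<gamma>" and \<eta>_pos: "0 < \<eta>" and \<eta>_eq: "\<eta> + \<eta> * \<kappa>1 = \<delta>"
proof -
  show "0 < \<gamma>" using pos by (simp add: \<gamma>_def)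
  show "0 < \<eta>" using pos nonneg by (simp add: \<eta>_def)
  have "\<eta> * (1 + \<kappa>1) = \<delta>" using nonneg by (simp add: \<eta>_def)
  then show "\<eta> + \<eta> * \<kappa>1 = \<delta>" by (simp add: algebra_simps)
qed

section \<open>Decrease along flows and at jumps\<close>

lemma lyap_has_derivative: "(lyap i w has_derivative dlyap i w p) (at p)"
proof -
  have dz: "((\<lambda>p. deviation (fst p) (fst (snd p)) w) has_derivative
      (\<lambda>h. fst h + X *v fst (snd h))) (at p)"
    unfolding deviation_def
    by (auto intro!: derivative_eq_intros bounded_linear.has_derivative[OF matrix_vector_mul_bounded_linear])
  have "((\<lambda>p. form i (deviation (fst p) (fst (snd p)) w)) has_derivative
      (\<lambda>h. deviation (fst p) (fst (snd p)) w \<bullet> (Q i *v (fst h + X *v fst (snd h)))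
         + (fst h + X *v fst (snd h)) \<bullet> (Q i *v deviation (fst p) (fst (snd p)) w))) (at p)"
    unfolding form_def
    by (intro has_derivative_inner dz bounded_linear.has_derivative[OF matrix_vector_mul_bounded_linear])
  moreover have "v \<bullet> (Q i *v h) + h \<bullet> (Q i *v v) = 2 * ((Q i *v v) \<bullet> h)" for v h
    using inner_symmetric_mult[OF Q_sym, of i v h] inner_commute[of h "Q i *v v"] by linarith
  ultimately have dQ: "((\<lambda>p. form i (deviation (fst p) (fst (snd p)) w)) has_derivative
      (\<lambda>h. 2 * ((Q i *v deviation (fst p) (fst (snd p)) w) \<bullet> (fst h + X *v fst (snd h))))) (at p)"
    by simp
  have dq: "((\<lambda>p. q w (fst (snd p))) has_derivative
      (\<lambda>h. fst (snd h) \<bullet> g w (fst (snd p)))) (at p)"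
    using grad[of w "fst (snd p)"] unfolding gderiv_def
    by (rule has_derivative_compose[rotated]) (auto intro!: derivative_eq_intros)
  show ?thesis
    unfolding lyap_def dlyap_def energy_def case_prod_beta'
    by (rule has_derivative_eq_rhs, (rule derivative_eq_intros dQ dq refl)+)
       (auto simp: fun_eq_iff algebra_simps)
qed

lemma dlyap_continuous: "continuous_on UNIV (\<lambda>p. dlyap i w p h)"
proof -
  have "continuous_on UNIV (q w)"
    using grad unfolding gderiv_def
    by (meson continuous_at_imp_continuous_on has_derivative_continuous)
  then have q: "continuous_on UNIV (\<lambda>p. q w (fst (snd p)))"
    by (rule continuous_on_compose2) (auto intro!: continuous_intros)
  have g: "continuous_on UNIV (\<lambda>p. g w (fst (snd p)))"
    by (rule continuous_on_compose2[OF grad_cont]) (auto intro!: continuous_intros)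
  show ?thesis
    unfolding dlyap_def energy_def form_def deviation_def case_prod_beta'
    by (intro continuous_intros q g
        continuous_on_compose2[OF matrix_vector_mult_linear_continuous_on]) auto
qed

lemma timer_weight_bounds:
  assumes "\<tau>1 \<in> {0..real N0}" "\<tau>2 \<in> {0..T0}"
  shows "1 \<le> exp (a * \<tau>1 + c * \<tau>2)" "exp (a * \<tau>1 + c * \<tau>2) \<le> \<Theta>"
proof -
  show "1 \<le> exp (a * \<tau>1 + c * \<tau>2)" using assms nonneg by simp
  have "a * \<tau>1 + c * \<tau>2 \<le> a * N0 + c * T0"
    using assms nonneg by (intro add_mono mult_left_mono) auto
  then show "exp (a * \<tau>1 + c * \<tau>2) \<le> \<Theta>" using \<Theta> by (meson exp_le_cancel_iff order_trans)
qed

lemma form_nonneg: "0 \<le> form i z"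
  using order_trans[OF _ Q_lower[of z i]] pos by (simp add: form_def)

lemma energy_nonneg:
  assumes "w \<in> W"
  shows "0 \<le> energy i w x u \<tau>1 \<tau>2"
proof -
  have "0 \<le> q w u" using order_trans[OF _ q_lower[OF assms, of u]] pos by simp
  then show ?thesis using form_nonneg \<gamma>_pos by (simp add: energy_def)
qed

text \<open>Along the flow \<open>z\<close> moves by \<open>A i *v z\<close> plus the drift
  \<open>X *v u'\<close> of the quasi-steady state, where \<open>u'\<close> is the velocity of
  \<open>u\<close>, and the controller differs from the true gradient by at most
  \<open>k * norm z\<close>. These are the cross terms that the locale assumption
  \<open>decay\<close> dominates.\<close>

lemma dlyap_decay:
  assumes w: "w \<in> W" and i: "i \<in> insert s Sa" and \<tau>: "\<tau>1 \<in> {0..real N0}" "\<tau>2 \<in> {0..T0}"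
    and v: "v \<in> flow_map sys (x, u, \<tau>1, \<tau>2, real i, w)"
  shows "dlyap i w (x, u, \<tau>1, \<tau>2, real i, w) v \<le> - \<eta> * lyap i w (x, u, \<tau>1, \<tau>2, real i, w)"
proof -
  define z where "z = deviation x u w"
  define ctrl where "ctrl = gradient fu u + transpose G *v gradient fy (C *v x)"
  define \<zeta> y t where "\<zeta> = norm z" and "y = norm (g w u)" and "t = exp (a * \<tau>1 + c * \<tau>2)"
  obtain d1 d2 where v_eq: "v = (A i *v x + B i *v u + E i *v w, - (\<epsilon> *\<^sub>R ctrl), d1, d2 - indicator Sa i, 0, 0)"
    and d: "0 \<le> d1" "d1 \<le> \<kappa>1" "d2 \<le> \<kappa>2"
    using v by (auto simp: attacked_system_def ctrl_def)
  have t: "1 \<le> t" "t \<le> \<Theta>" using timer_weight_bounds[OF \<tau>] by (simp_all add: t_def)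
  have "x = z + (- (X *v u) - Y *v w)" by (simp add: z_def deviation_def)
  then have "A i *v x = A i *v z + A i *v (- (X *v u) - Y *v w)"
    by (metis matrix_vector_right_distrib)
  then have flow_x: "A i *v x + B i *v u + E i *v w = A i *v z"
    using equilibrium[OF i w, of u] by (simp only: add.assoc) simp
  have err: "norm (ctrl - g w u) \<le> k * \<zeta>"
    using controller[OF w] by (simp add: ctrl_def \<zeta>_def z_def deviation_def)
  have "norm ctrl \<le> y + k * \<zeta>"
    using norm_triangle_sub[of ctrl "g w u"] err by (simp add: y_def)
  then have "b * \<zeta> * norm (- (\<epsilon> *\<^sub>R ctrl)) \<le> b * \<zeta> * (\<epsilon> * (y + k * \<zeta>))"
    using nonneg pos by (intro mult_left_mono) (auto simp: \<zeta>_def)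
  then have "(Q i *v z) \<bullet> (X *v - (\<epsilon> *\<^sub>R ctrl)) \<le> b * \<zeta> * (\<epsilon> * (y + k * \<zeta>))"
    using Q_coupling[of i z "- (\<epsilon> *\<^sub>R ctrl)"] unfolding \<zeta>_def by linarith
  then have "2 * ((Q i *v z) \<bullet> (A i *v z + X *v - (\<epsilon> *\<^sub>R ctrl)))
      \<le> rate i * form i z + 2 * b * \<epsilon> * \<zeta> * (y + k * \<zeta>)"
    using Q_rate[OF i, of z] by (simp add: form_def inner_add_right algebra_simps)
  \<comment> \<open>The velocity of the timer weight replaces the mode-dependent
    \<open>rate i\<close> by the common bound \<open>- \<rho>\<close>.\<close>
  moreover have "(a * d1 + c * (d2 - indicator Sa i)) * form i z \<le> (- \<rho> - rate i) * form i z"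
  proof (rule mult_right_mono)
    have "a * d1 + c * (d2 - indicator Sa i) \<le> a * \<kappa>1 + c * (\<kappa>2 - indicator Sa i)"
      using nonneg d by (intro add_mono mult_left_mono) auto
    then show "a * d1 + c * (d2 - indicator Sa i) \<le> - \<rho> - rate i" using rate[OF i] by simp
    show "0 \<le> form i z" by (rule form_nonneg)
  qed
  ultimately have "2 * ((Q i *v z) \<bullet> (A i *v z + X *v - (\<epsilon> *\<^sub>R ctrl)))
      + (a * d1 + c * (d2 - indicator Sa i)) * form i z
      \<le> - \<rho> * form i z + 2 * b * \<epsilon> * \<zeta> * (y + k * \<zeta>)"
    by (simp add: algebra_simps)
  then have 1: "\<gamma> * t * (2 * ((Q i *v z) \<bullet> (A i *v z + X *v - (\<epsilon> *\<^sub>R ctrl)))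
      + (a * d1 + c * (d2 - indicator Sa i)) * form i z)
      \<le> \<gamma> * t * (- \<rho> * form i z + 2 * b * \<epsilon> * \<zeta> * (y + k * \<zeta>))"
    using \<gamma>_pos t by (intro mult_left_mono) auto
  have "\<bar>(ctrl - g w u) \<bullet> g w u\<bar> \<le> (k * \<zeta>) * y"
    using Cauchy_Schwarz_ineq2[of "ctrl - g w u" "g w u"] mult_right_mono[OF err, of y]
    by (simp add: y_def)
  then have "- ((ctrl - g w u) \<bullet> g w u) \<le> (k * \<zeta>) * y" by linarith
  then have "- (ctrl \<bullet> g w u) \<le> - y\<^sup>2 + k * \<zeta> * y"
    by (simp add: inner_diff_left y_def power2_norm_eq_inner)
  then have "\<epsilon> * - (ctrl \<bullet> g w u) \<le> \<epsilon> * (- y\<^sup>2 + k * \<zeta> * y)"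
    using nonneg by (intro mult_left_mono) auto
  then have 2: "- (\<epsilon> *\<^sub>R ctrl) \<bullet> g w u \<le> - \<epsilon> * y\<^sup>2 + \<epsilon> * k * \<zeta> * y"
    by (simp add: algebra_simps)
  define e where "e = \<gamma> * t * form i z + q w u"
  have e: "energy i w x u \<tau>1 \<tau>2 = e" by (simp add: energy_def e_def t_def z_def)
  have e0: "0 \<le> e" using energy_nonneg[OF w, of i x u \<tau>1 \<tau>2] by (simp add: e)
  have "\<gamma> * t * (- \<rho> * form i z + 2 * b * \<epsilon> * \<zeta> * (y + k * \<zeta>)) - \<epsilon> * y\<^sup>2 + \<epsilon> * k * \<zeta> * y \<le> - \<delta> * e"
    unfolding \<gamma>_def e_def using q_upper[OF w] Q_lower
    by (intro decay t) (auto simp: \<zeta>_def y_def form_def)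
  moreover have "\<eta> * d1 * e \<le> \<eta> * \<kappa>1 * e"
    using \<eta>_pos d e0 by (intro mult_right_mono mult_left_mono) auto
  moreover have "- \<delta> * e + \<eta> * \<kappa>1 * e = - \<eta> * e"
    using arg_cong[OF \<eta>_eq, of "\<lambda>r. r * e"] by (simp only: distrib_right)
  ultimately have "\<gamma> * t * (2 * ((Q i *v z) \<bullet> (A i *v z + X *v - (\<epsilon> *\<^sub>R ctrl)))
      + (a * d1 + c * (d2 - indicator Sa i)) * form i z) + - (\<epsilon> *\<^sub>R ctrl) \<bullet> g w u + \<eta> * d1 * e
      \<le> - \<eta> * e"
    using 1 2 by linarith
  then have "exp (\<eta> * \<tau>1) * (\<gamma> * t * (2 * ((Q i *v z) \<bullet> (A i *v z + X *v - (\<epsilon> *\<^sub>R ctrl)))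
      + (a * d1 + c * (d2 - indicator Sa i)) * form i z) + - (\<epsilon> *\<^sub>R ctrl) \<bullet> g w u + \<eta> * d1 * e)
      \<le> exp (\<eta> * \<tau>1) * (- \<eta> * e)"
    by (intro mult_left_mono) auto
  then show ?thesis
    by (simp only: v_eq dlyap_def lyap_def prod.case flow_x e t_def[symmetric] z_def[symmetric])
       (simp add: mult_ac)
qed

text \<open>\<open>nat\<close> of the floor decodes the mode from its real embedding; only values at
  states of the flow set matter.\<close>

definition total_lyap :: "('n, 'm, 'q) state \<Rightarrow> real" where
  "total_lyap = (\<lambda>(x, u, \<tau>1, \<tau>2, \<sigma>, w). lyap (nat \<lfloor>\<sigma>\<rfloor>) w (x, u, \<tau>1, \<tau>2, \<sigma>, w))"

lemma total_lyap_eq: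
  "total_lyap (x, u, \<tau>1, \<tau>2, real i, w) = exp (\<eta> * \<tau>1) * energy i w x u \<tau>1 \<tau>2"
  by (simp add: total_lyap_def lyap_def)

lemma flow_setE:
  assumes "p \<in> flow_set sys"
  obtains x u \<tau>1 \<tau>2 i w where "p = (x, u, \<tau>1, \<tau>2, real i, w)" "i \<in> insert s Sa" "w \<in> W"
    "\<tau>1 \<in> {0..real N0}" "\<tau>2 \<in> {0..T0}"
  using assms unfolding attacked_system_def by auto

text \<open>Mode and disturbance keep their initial values during a flow, so
  \<open>total_lyap\<close> agrees there with the smooth \<open>lyap i w\<close> for fixed
  \<open>i\<close> and \<open>w\<close>.\<close>

lemma total_lyap_flow:
  assumes "t0 < t1" and ac: "abs_continuous_on {t0..t1} p"
    and C: "\<And>t. t \<in> {t0..t1} \<Longrightarrow> p t \<in> flow_set sys"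
    and ae: "AE t in lebesgue. t \<in> {t0<..<t1} \<longrightarrow>
      (\<exists>v\<in>flow_map sys (p t). (p has_vector_derivative v) (at t))"
  shows "total_lyap (p t1) \<le> exp (- \<eta> * (t1 - t0)) * total_lyap (p t0)"
proof -
  have "p t0 \<in> flow_set sys" using C \<open>t0 < t1\<close> by simp
  then obtain x0 u0 \<tau>10 \<tau>20 i w where p0: "p t0 = (x0, u0, \<tau>10, \<tau>20, real i, w)"
    and i: "i \<in> insert s Sa" and w: "w \<in> W"
    by (rule flow_setE)
  \<comment> \<open>Test vectors supported on the last two components see only the velocities that
    are identically zero.\<close>
  have const: "p t \<bullet> (0, 0, 0, 0, r, y) = p t0 \<bullet> (0, 0, 0, 0, r, y)" if t: "t \<in> {t0..t1}" for t r y
  proof (rule constant_along_flow)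
    show "abs_continuous_on {t0..t} p" by (rule abs_continuous_on_subset[OF ac]) (use t in auto)
    show "t0 \<le> t" using t by simp
    have "v \<bullet> (0, 0, 0, 0, r, y) = 0" if "v \<in> flow_map sys (p s)" for v s
      using that by (auto simp: attacked_system_def split: prod.splits)
    then show "AE s in lebesgue. s \<in> {t0<..<t} \<longrightarrow>
        (\<exists>v. (p has_vector_derivative v) (at s) \<and> v \<bullet> (0, 0, 0, 0, r, y) = 0)"
      using ae by (rule_tac eventually_mono[OF ae]) (use t in fastforce)
  qed
  have pt: "\<exists>x u \<tau>1 \<tau>2. p t = (x, u, \<tau>1, \<tau>2, real i, w) \<and> \<tau>1 \<in> {0..real N0} \<and> \<tau>2 \<in> {0..T0}"
    if t: "t \<in> {t0..t1}" for t
  proof -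
    obtain x u \<tau>1 \<tau>2 j w' where pt: "p t = (x, u, \<tau>1, \<tau>2, real j, w')"
      and \<tau>: "\<tau>1 \<in> {0..real N0}" "\<tau>2 \<in> {0..T0}"
      using flow_setE[OF C[OF t]] by metis
    have "real j = real i" using const[OF t, of 1 0] by (simp add: pt p0)
    moreover have "w' \<bullet> y = w \<bullet> y" for y using const[OF t, of 0 y] by (simp add: pt p0)
    then have "w' = w" by (metis vector_eq_rdot)
    ultimately show ?thesis using pt \<tau> by auto
  qed
  have "AE t in lebesgue. t \<in> {t0<..<t1} \<longrightarrow>
      (\<exists>v. (p has_vector_derivative v) (at t) \<and> dlyap i w (p t) v \<le> - \<eta> * lyap i w (p t))"
    using ae
  proof eventually_elim
    case (elim t)
    show ?case
    proof
      assume t: "t \<in> {t0<..<t1}"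
      then obtain v where v: "v \<in> flow_map sys (p t)" "(p has_vector_derivative v) (at t)"
        using elim by blast
      have "t \<in> {t0..t1}" using t by simp
      then obtain x u \<tau>1 \<tau>2 where x: "p t = (x, u, \<tau>1, \<tau>2, real i, w)"
        and \<tau>: "\<tau>1 \<in> {0..real N0}" "\<tau>2 \<in> {0..T0}"
        using pt by blast
      have "dlyap i w (p t) v \<le> - \<eta> * lyap i w (p t)"
        using dlyap_decay[OF w i \<tau>] v(1) unfolding x .
      then show "\<exists>v. (p has_vector_derivative v) (at t) \<and> dlyap i w (p t) v \<le> - \<eta> * lyap i w (p t)"
        using v(2) by blast
    qed
  qed
  then have "lyap i w (p t1) \<le> exp (- \<eta> * (t1 - t0)) * lyap i w (p t0)"
    using \<open>t0 < t1\<close>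
    by (intro lyapunov_decay_along_flow[OF lyap_has_derivative dlyap_continuous ac]) auto
  moreover have "total_lyap (p t) = lyap i w (p t)" if "t \<in> {t0..t1}" for t
    using pt[OF that] by (auto simp: total_lyap_def lyap_def)
  ultimately show ?thesis using \<open>t0 < t1\<close> by simp
qed

text \<open>Lowering \<open>\<tau>1\<close> by one shrinks the timer weight by \<open>exp a\<close>,
  which offsets the change of matrix; the factor \<open>exp (\<eta> * \<tau>1)\<close> supplies the
  strict decrease.\<close>

lemma total_lyap_jump:
  assumes "p \<in> jump_set sys" "p' \<in> jump_map sys p"
  shows "total_lyap p' \<le> exp (- \<eta>) * total_lyap p"
proof -
  obtain x u \<tau>1 \<tau>2 i w where p: "p = (x, u, \<tau>1, \<tau>2, real i, w)" "w \<in> W"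
    using assms(1) by (auto simp: attacked_system_def)
  then obtain j where p': "p' = (x, u, \<tau>1 - 1, \<tau>2, real j, w)"
    using assms(2) by (auto simp: attacked_system_def)
  define z where "z = deviation x u w"
  have "form j z \<le> exp a * form i z" using Q_jump[where i = i and j = j] by (simp add: form_def)
  then have "\<gamma> * exp (a * (\<tau>1 - 1) + c * \<tau>2) * form j z
      \<le> \<gamma> * exp (a * (\<tau>1 - 1) + c * \<tau>2) * (exp a * form i z)"
    using \<gamma>_pos by (intro mult_left_mono) auto
  also have "\<dots> = \<gamma> * (exp (a * (\<tau>1 - 1) + c * \<tau>2) * exp a) * form i z" by simp
  also have "exp (a * (\<tau>1 - 1) + c * \<tau>2) * exp a = exp (a * \<tau>1 + c * \<tau>2)"
    by (simp add: algebra_simps flip: exp_add)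
  finally have "energy j w x u (\<tau>1 - 1) \<tau>2 \<le> energy i w x u \<tau>1 \<tau>2"
    by (simp add: energy_def z_def)
  then have "exp (\<eta> * (\<tau>1 - 1)) * energy j w x u (\<tau>1 - 1) \<tau>2
      \<le> exp (\<eta> * (\<tau>1 - 1)) * energy i w x u \<tau>1 \<tau>2"
    by (intro mult_left_mono) auto
  also have "\<dots> = exp (- \<eta>) * (exp (\<eta> * \<tau>1) * energy i w x u \<tau>1 \<tau>2)"
    unfolding mult.assoc[symmetric] exp_add[symmetric] by (simp add: algebra_simps)
  finally show ?thesis unfolding p p' total_lyap_eq .
qed

section \<open>The attractor and quadratic bounds in the distance to it\<close>

definition attractor :: "('n, 'm, 'q) state set" where
  "attractor = {(x, u, \<tau>1, \<tau>2, real \<sigma>, w) | x u \<tau>1 \<tau>2 \<sigma> w.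
     x = - (X *v ustar w) - Y *v w \<and> u = ustar w \<and> \<tau>1 \<in> {0..real N0} \<and> \<tau>2 \<in> {0..T0} \<and>
     \<sigma> \<in> insert s Sa \<and> w \<in> W}"

text \<open>The set is the continuous image of the compact set of admissible disturbances, timers
  and modes.\<close>

lemma compact_attractor: "compact attractor"
proof -
  have cont: "continuous_on (W \<times> {0..real N0} \<times> {0..T0} \<times> real ` insert s Sa) (\<lambda>v. ustar (fst v))"
    by (rule continuous_on_compose2[OF lipschitz_on_continuous_on[OF ustar_lipschitz]])
       (auto intro!: continuous_intros)
  have comp: "compact (W \<times> {0..real N0} \<times> {0..T0} \<times> real ` insert s Sa)"
    using W(1) Sa by (simp add: compact_Times finite_imp_compact)
  have "p \<in> attractor \<longleftrightarrow> p \<in> (\<lambda>(w, \<tau>1, \<tau>2, \<sigma>). (- (X *v ustar w) - Y *v w, ustar w, \<tau>1, \<tau>2, \<sigma>, w)) `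
      (W \<times> {0..real N0} \<times> {0..T0} \<times> real ` insert s Sa)" for p
    by (cases p) (auto simp: attractor_def image_iff)
  then have eq: "attractor = (\<lambda>(w, \<tau>1, \<tau>2, \<sigma>). (- (X *v ustar w) - Y *v w, ustar w, \<tau>1, \<tau>2, \<sigma>, w)) `
      (W \<times> {0..real N0} \<times> {0..T0} \<times> real ` insert s Sa)"
    by (rule set_eqI)
  show ?thesis
    unfolding eq case_prod_beta'
    by (intro compact_continuous_image[OF _ comp] continuous_intros cont
        continuous_on_compose2[OF matrix_vector_mult_linear_continuous_on cont]
        continuous_on_compose2[OF matrix_vector_mult_linear_continuous_on]) auto
qed

lemma attractor_nonempty: "attractor \<noteq> {}"
proof -
  obtain w where "w \<in> W" using W(2) by blast
  then have "(- (X *v ustar w) - Y *v w, ustar w, 0, 0, real s, w) \<in> attractor"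
    using nonneg by (auto simp: attractor_def)
  then show ?thesis by blast
qed

text \<open>The distance is at most that to the attractor point with the same timers, mode and
  disturbance, where only \<open>x\<close> and \<open>u\<close> differ; \<open>x\<close> is off by
  \<open>z - X *v d\<close>.\<close>

lemma total_lyap_lower:
  obtains \<alpha> where "0 < \<alpha>" "\<And>p. p \<in> flow_set sys \<Longrightarrow> \<alpha> * (infdist p attractor)\<^sup>2 \<le> total_lyap p"
proof
  define K where "K = 1 + spectral_norm X"
  define \<alpha> where "\<alpha> = min (\<gamma> * m / 2) (\<mu> / (4 * K\<^sup>2))"
  have K: "0 < K" using spectral_norm_nonneg[of X] by (simp add: K_def)
  then show \<alpha>: "0 < \<alpha>" using \<gamma>_pos pos by (simp add: \<alpha>_def)
  have \<alpha>1: "2 * \<alpha> \<le> \<gamma> * m" by (simp add: \<alpha>_def min_def)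
  have "\<alpha> \<le> \<mu> / (4 * K\<^sup>2)" by (simp add: \<alpha>_def)
  then have \<alpha>2: "2 * \<alpha> * K\<^sup>2 \<le> \<mu> / 2" using K by (simp add: field_simps)
  fix p assume "p \<in> flow_set sys"
  then obtain x u \<tau>1 \<tau>2 i w where p: "p = (x, u, \<tau>1, \<tau>2, real i, w)" "i \<in> insert s Sa"
    and w: "w \<in> W" and \<tau>: "\<tau>1 \<in> {0..real N0}" "\<tau>2 \<in> {0..T0}"
    by (rule flow_setE)
  define xs where "xs = - (X *v ustar w) - Y *v w"
  define z where "z = deviation x u w"
  define d where "d = u - ustar w"
  have "(xs, ustar w, \<tau>1, \<tau>2, real i, w) \<in> attractor"
    unfolding attractor_def xs_def using w \<tau> p(2) by force
  then have "infdist p attractor \<le> dist p (xs, ustar w, \<tau>1, \<tau>2, real i, w)" by (rule infdist_le)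
  also have "\<dots> \<le> norm (x - xs) + norm d"
    using norm_Pair_le[of "x - xs" "(d, 0 :: real \<times> real \<times> real \<times> real^'q)"]
    by (simp add: p(1) dist_norm d_def zero_prod_def norm_Pair)
  also have "x - xs = z - X *v d"
    by (simp add: xs_def z_def d_def deviation_def matrix_vector_mult_diff_distrib)
  also have "norm (z - X *v d) \<le> norm z + spectral_norm X * norm d"
    by (rule order_trans[OF norm_triangle_ineq4 add_left_mono[OF norm_mult_le_spectral_norm]])
  finally have "infdist p attractor \<le> norm z + K * norm d" by (simp add: K_def algebra_simps)
  then have "(infdist p attractor)\<^sup>2 \<le> (norm z + K * norm d)\<^sup>2"
    by (intro power_mono infdist_nonneg)
  also have "\<dots> \<le> 2 * (norm z)\<^sup>2 + 2 * K\<^sup>2 * (norm d)\<^sup>2"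
    using zero_le_power2[of "norm z - K * norm d"]
    by (simp add: power2_sum power2_diff power_mult_distrib)
  finally have "\<alpha> * (infdist p attractor)\<^sup>2 \<le> \<alpha> * (2 * (norm z)\<^sup>2 + 2 * K\<^sup>2 * (norm d)\<^sup>2)"
    using \<alpha> by (intro mult_left_mono) auto
  also have "\<dots> = 2 * \<alpha> * (norm z)\<^sup>2 + 2 * \<alpha> * K\<^sup>2 * (norm d)\<^sup>2" by (simp add: algebra_simps)
  also have "\<dots> \<le> \<gamma> * m * (norm z)\<^sup>2 + \<mu> / 2 * (norm d)\<^sup>2"
    by (intro add_mono mult_right_mono \<alpha>1 \<alpha>2) auto
  also have "\<dots> \<le> \<gamma> * form i z + q w u"
    unfolding form_def d_def mult.assoc[of \<gamma>]
    by (intro add_mono mult_left_mono Q_lower q_lower w less_imp_le[OF \<gamma>_pos])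
  also have "\<dots> \<le> energy i w x u \<tau>1 \<tau>2"
    using mult_right_mono[OF timer_weight_bounds(1)[OF \<tau>], of "\<gamma> * form i z"] form_nonneg \<gamma>_pos
    by (simp add: energy_def z_def mult_ac)
  also have "\<dots> \<le> total_lyap p"
    using mult_right_mono[of 1 "exp (\<eta> * \<tau>1)", OF _ energy_nonneg[OF w]] \<eta>_pos \<tau>
    by (simp add: p(1) total_lyap_eq)
  finally show "\<alpha> * (infdist p attractor)\<^sup>2 \<le> total_lyap p" .
qed

text \<open>The nearest attractor point may carry a different disturbance \<open>w'\<close>. Its
  equilibrium is compared with that of \<open>w\<close> through \<open>Y\<close> and the Lipschitz
  constant of \<open>ustar\<close>, whence \<open>K1\<close> and \<open>K2\<close>.\<close>

lemma total_lyap_upper: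
  obtains \<beta> where "0 < \<beta>" "\<And>p. p \<in> flow_set sys \<Longrightarrow> total_lyap p \<le> \<beta> * (infdist p attractor)\<^sup>2"
proof
  define K1 where "K1 = 1 + spectral_norm X + spectral_norm Y"
  define K2 where "K2 = 1 + Lu"
  define \<beta> where "\<beta> = exp (\<eta> * N0) * (\<gamma> * \<Theta> * (M * K1\<^sup>2) + l\<^sup>2 / (2 * \<mu>) * K2\<^sup>2)"
  have K: "0 < K1" "0 < K2"
    using spectral_norm_nonneg[of X] spectral_norm_nonneg[of Y] lipschitz_on_nonneg[OF ustar_lipschitz]
    by (simp_all add: K1_def K2_def)
  have \<Theta>0: "0 < \<Theta>" using \<Theta> by (meson exp_gt_zero less_le_trans)
  show "0 < \<beta>"
    unfolding \<beta>_def using K \<Theta>0 \<gamma>_pos pos by (intro mult_pos_pos add_pos_nonneg) auto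
  fix p assume "p \<in> flow_set sys"
  then obtain x u \<tau>1 \<tau>2 i w where p: "p = (x, u, \<tau>1, \<tau>2, real i, w)" "i \<in> insert s Sa"
    and w: "w \<in> W" and \<tau>: "\<tau>1 \<in> {0..real N0}" "\<tau>2 \<in> {0..T0}"
    by (rule flow_setE)
  obtain y where y: "y \<in> attractor" "infdist p attractor = dist p y"
    using infdist_attains_inf[OF compact_imp_closed[OF compact_attractor] attractor_nonempty] by blast
  then obtain w' \<tau>1' \<tau>2' \<sigma>' where w': "w' \<in> W"
    and y_eq: "y = (- (X *v ustar w') - Y *v w', ustar w', \<tau>1', \<tau>2', \<sigma>', w')"
    by (auto simp: attractor_def)
  define r where "r = infdist p attractor"
  define xs where "xs = - (X *v ustar w') - Y *v w'"
  have r0: "0 \<le> r" by (simp add: r_def infdist_nonneg)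
  have r: "r = norm (x - xs, u - ustar w', \<tau>1 - \<tau>1', \<tau>2 - \<tau>2', real i - \<sigma>', w - w')"
    unfolding r_def y(2) by (simp add: dist_norm p(1) y_eq xs_def)
  have rx: "norm (x - xs) \<le> r" unfolding r by (rule norm_fst_le)
  have ru: "norm (u - ustar w') \<le> r"
    unfolding r by (rule order_trans[OF norm_fst_le norm_snd_le])
  have rw: "norm (w - w') \<le> r"
    unfolding r
    by (rule order_trans[OF order_trans[OF order_trans[OF order_trans[OF norm_snd_le norm_snd_le]
            norm_snd_le] norm_snd_le] norm_snd_le])
  define z where "z = deviation x u w"
  have "z = (x - xs) + X *v (u - ustar w') + Y *v (w - w')"
    by (simp add: z_def deviation_def xs_def matrix_vector_mult_diff_distrib)
  then have "norm z \<le> norm (x - xs) + norm (X *v (u - ustar w')) + norm (Y *v (w - w'))"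
    by (metis norm_triangle_ineq norm_triangle_mono order_refl)
  also have "\<dots> \<le> r + spectral_norm X * r + spectral_norm Y * r"
    by (intro add_mono rx order_trans[OF norm_mult_le_spectral_norm mult_left_mono[OF ru]]
        order_trans[OF norm_mult_le_spectral_norm mult_left_mono[OF rw]] spectral_norm_nonneg)
  finally have z: "norm z \<le> K1 * r" by (simp add: K1_def algebra_simps)
  have "norm (ustar w' - ustar w) \<le> Lu * norm (w' - w)"
    using lipschitz_onD[OF ustar_lipschitz w' w] by (simp add: dist_norm)
  also have "\<dots> \<le> Lu * r"
    using rw lipschitz_on_nonneg[OF ustar_lipschitz]
    by (intro mult_left_mono) (auto simp: norm_minus_commute)
  finally have u: "norm (u - ustar w) \<le> K2 * r"
    using norm_triangle_ineq[of "u - ustar w'" "ustar w' - ustar w"] ru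
    by (simp add: K2_def algebra_simps)
  have "form i z \<le> M * (norm z)\<^sup>2" using Q_upper by (simp add: form_def)
  also have "\<dots> \<le> M * (K1 * r)\<^sup>2" using z pos by (intro mult_left_mono power_mono) auto
  finally have F: "form i z \<le> M * K1\<^sup>2 * r\<^sup>2" by (simp add: power_mult_distrib)
  have "norm (g w u) \<le> \<bar>l\<bar> * norm (u - ustar w)"
    by (rule order_trans[OF grad_upper[OF w] mult_right_mono]) auto
  also have "\<dots> \<le> \<bar>l\<bar> * (K2 * r)" using u by (intro mult_left_mono) auto
  finally have "(norm (g w u))\<^sup>2 \<le> (\<bar>l\<bar> * (K2 * r))\<^sup>2" by (intro power_mono) auto
  then have "(norm (g w u))\<^sup>2 / (2 * \<mu>) \<le> (l\<^sup>2 * K2\<^sup>2 * r\<^sup>2) / (2 * \<mu>)"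
    using pos by (intro divide_right_mono) (auto simp: power_mult_distrib)
  then have qb: "q w u \<le> l\<^sup>2 / (2 * \<mu>) * K2\<^sup>2 * r\<^sup>2" using q_upper[OF w, of u] by simp
  have "energy i w x u \<tau>1 \<tau>2 \<le> \<gamma> * \<Theta> * (M * K1\<^sup>2 * r\<^sup>2) + l\<^sup>2 / (2 * \<mu>) * K2\<^sup>2 * r\<^sup>2"
    unfolding energy_def z_def[symmetric]
    using timer_weight_bounds(2)[OF \<tau>] \<gamma>_pos \<Theta>0 form_nonneg F qb
    by (intro add_mono mult_mono) auto
  then have "exp (\<eta> * \<tau>1) * energy i w x u \<tau>1 \<tau>2
      \<le> exp (\<eta> * N0) * (\<gamma> * \<Theta> * (M * K1\<^sup>2 * r\<^sup>2) + l\<^sup>2 / (2 * \<mu>) * K2\<^sup>2 * r\<^sup>2)"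
    using \<eta>_pos \<tau> energy_nonneg[OF w] by (intro mult_mono) auto
  also have "\<dots> = \<beta> * r\<^sup>2" by (simp add: \<beta>_def algebra_simps)
  finally show "total_lyap p \<le> \<beta> * (infdist p attractor)\<^sup>2"
    by (simp add: p(1) total_lyap_eq r_def)
qed

lemma UGES_attractor: "UGES sys attractor"
proof -
  obtain \<alpha> where \<alpha>: "0 < \<alpha>" "\<And>p. p \<in> flow_set sys \<Longrightarrow> \<alpha> * (infdist p attractor)\<^sup>2 \<le> total_lyap p"
    using total_lyap_lower by blast
  obtain \<beta> where \<beta>: "0 < \<beta>" "\<And>p. p \<in> flow_set sys \<Longrightarrow> total_lyap p \<le> \<beta> * (infdist p attractor)\<^sup>2"
    using total_lyap_upper by blast
  have closed: "closed (flow_set sys)"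
    using Sa W(1)
    by (simp add: attacked_system_def closed_Times compact_imp_closed finite_imp_closed)
  have sub: "attractor \<subseteq> flow_set sys \<union> jump_set sys"
    by (auto simp: attacked_system_def attractor_def)
  have jump: "jump_set sys \<subseteq> flow_set sys"
    by (auto simp: attacked_system_def)
  have jump_inv: "y \<in> flow_set sys" if "x \<in> jump_set sys" "y \<in> jump_map sys x" for x y
    using that by (auto simp: attacked_system_def)
  show ?thesis
    by (rule UGES_if_lyapunov[where V = total_lyap and c = \<eta> and \<alpha> = \<alpha> and \<beta> = \<beta>])
       (fact compact_attractor closed sub jump jump_inv total_lyap_flow total_lyap_jump \<alpha> \<beta> \<eta>_pos)+
qed

end

section \<open>Stability\<close>

theorem proposition4:
  fixes F :: "real^'n^'n" and N :: "real^'mv^'n" and B :: "real^'m^'n" and E :: "real^'q^'n"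
    and C :: "real^'n^'p" and K :: "real^'p^'mv"
    and fu :: "real^'m \<Rightarrow> real" and fy :: "real^'p \<Rightarrow> real"
    and s :: nat and Sva Sua :: "nat set"
    and L :: "nat \<Rightarrow> real^'mv^'mv" and Lb Le :: "nat \<Rightarrow> real^'n^'n" and M :: "nat \<Rightarrow> real^'m^'m"
    and \<phi> :: "real^'q \<Rightarrow> real^'q" and W :: "(real^'q) set" and wbar :: real
    and R P :: "real^'n^'n" and lu ly \<mu> :: real
    and h :: "real^'q \<Rightarrow> real^'m" and U :: "(real^'q) set"
    and N0 :: nat and T0 \<kappa>1 \<kappa>2 \<epsilon> \<beta> :: real
    and A :: "real^'n^'n" and G :: "real^'m^'p" and H :: "real^'q^'p"
    and f :: "real^'m \<Rightarrow> real^'q \<Rightarrow> real"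
    and A\<sigma> :: "nat \<Rightarrow> real^'n^'n" and B\<sigma> :: "nat \<Rightarrow> real^'m^'n" and E\<sigma> :: "nat \<Rightarrow> real^'q^'n"
    and ustar :: "real^'q \<Rightarrow> real^'m" and xstar :: "real^'m \<Rightarrow> real^'q \<Rightarrow> real^'n"
    and l eig_a \<omega> \<rho> \<tau>0 :: real
  assumes A_eq: "A = F + N ** K ** C"
    and G_eq: "G = - (C ** matrix_inv A ** B)"
    and H_eq: "H = - (C ** matrix_inv A ** E)"
    and f_eq: "f = (\<lambda>u w. fu u + fy (G *v u + H *v w))"
    and A\<sigma>_eq: "A\<sigma> = (\<lambda>\<sigma>. F + N ** L \<sigma> ** K ** C)"
    and B\<sigma>_eq: "B\<sigma> = (\<lambda>\<sigma>. Lb \<sigma> ** B)"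
    and E\<sigma>_eq: "E\<sigma> = (\<lambda>\<sigma>. Le \<sigma> ** E)"
    and ustar_eq: "ustar = (\<lambda>w. THE u. is_arg_min (\<lambda>u. f u w) (\<lambda>_. True) u)"
    and xstar_eq: "xstar = (\<lambda>u w. - (matrix_inv A ** B *v u) - matrix_inv A ** E *v w)"
    and l_eq: "l = lu + ly * (spectral_norm G)\<^sup>2"
    and eig_a_eq: "eig_a = Max ((\<lambda>\<sigma>. lambda_max (transpose (A\<sigma> \<sigma>) + A\<sigma> \<sigma>)) ` Sva)"
    and \<omega>_eq: "\<omega> = max (lambda_max P / \<beta>) (\<beta> / lambda_min P)"
    and \<rho>_eq: "\<rho> = lambda_min R / lambda_max P - \<kappa>2 * (lambda_min R / lambda_max P + eig_a) - ln \<omega> * \<kappa>1"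
    and \<tau>0_eq: "\<tau>0 = ln \<omega> * real N0 + T0 * (lambda_min R / lambda_max P + eig_a)"
    and mode_indices: "0 \<notin> Sva" "0 \<notin> Sua" "s \<notin> Sva" "s \<notin> Sua" "Sva \<noteq> {}"
    and nominal: "L s = mat 1" "Lb s = mat 1" "Le s = mat 1" "M s = mat 1"
    and A1: "\<exists>c. c-lipschitz_on UNIV \<phi>" "compact W" "W \<subseteq> cball 0 wbar" "forward_invariant \<phi> W"
    and A2: "\<forall>Q. pos_def Q \<longrightarrow> (\<exists>!S. pos_def S \<and> transpose A ** S + S ** A = - Q)"
    and RP: "pos_def R" "pos_def P" "transpose A ** P + P ** A = - R"
    and A3: "cont_differentiable fu" "cont_differentiable fy" "lu > 0" "ly > 0"
      "lu-lipschitz_on UNIV (gradient fu)" "ly-lipschitz_on UNIV (gradient fy)"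
    and A4: "\<forall>w. \<exists>!u. is_arg_min (\<lambda>u. f u w) (\<lambda>_. True) u" "\<mu> > 0"
      "\<forall>u. \<forall>w\<in>W. 1 / 2 * (norm (gradient (\<lambda>u. f u w) u))\<^sup>2 \<ge> \<mu> * (f u w - f (ustar w) w)"
    and A5: "\<forall>w\<in>W. ustar w = h w" "W \<subseteq> U" "cont_differentiable_on h U"
    and A6: "finite (insert s Sva)" "finite (insert s Sua)"
      "\<forall>\<sigma>\<in>Sva. invertible (A\<sigma> \<sigma>) \<and> (\<exists>z\<in>eigenvalues (complex_matrix (A\<sigma> \<sigma>)). Re z > 0)"
      "\<forall>\<sigma>\<in>Sua. \<exists>z\<in>eigenvalues (complex_matrix (M \<sigma>)). Re z < 0"
    and A7: "\<forall>w\<in>W. \<forall>u. \<exists>!x. \<forall>\<sigma>\<in>insert s Sva. 0 = A\<sigma> \<sigma> *v x + B\<sigma> \<sigma> *v u + E\<sigma> \<sigma> *v w"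
    and timer_params: "N0 \<ge> 1" "T0 \<ge> 0" "\<kappa>1 > 0" "0 < \<kappa>2" "\<kappa>2 < 1"
    and \<beta>_pos: "\<beta> > 0"
    and gain: "lambda_min R
      > lambda_max P * ln \<omega> * \<kappa>1 + \<kappa>2 * (lambda_min R + lambda_max P * eig_a)"
    and \<epsilon>_bounds: "0 < \<epsilon>"
      "ereal \<epsilon> < ereal (\<rho> * min (lambda_min P) \<beta> * \<mu>\<^sup>2)
         / ereal (2 * ly * exp \<tau>0 * spectral_norm C * spectral_norm G
             * spectral_norm (matrix_inv A ** B) * max (lambda_max P) \<beta> * (\<mu>\<^sup>2 + l\<^sup>2))"
  shows "UGES (attacked_system A\<sigma> B\<sigma> E\<sigma> C G fu fy s Sva W (\<lambda>_. 0) N0 T0 \<kappa>1 \<kappa>2 \<epsilon>)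
    {(x, u, \<tau>1, \<tau>2, real \<sigma>, w) | x u \<tau>1 \<tau>2 \<sigma> w.
       x = xstar (ustar w) w \<and> u = ustar w \<and> \<tau>1 \<in> {0..real N0} \<and> \<tau>2 \<in> {0..T0} \<and>
       \<sigma> \<in> insert s Sva \<and> w \<in> W}"
proof (cases "W = {}")
  \<comment> \<open>Without disturbances the flow set, the jump set and the attractor are all
    empty.\<close>
  case True
  then show ?thesis
    using UGES_empty_system[of "attacked_system A\<sigma> B\<sigma> E\<sigma> C G fu fy s Sva W (\<lambda>_. 0) N0 T0 \<kappa>1 \<kappa>2 \<epsilon>"]
    by (simp add: attacked_system_def)
next
  case False
  define X where "X = matrix_inv A ** B"
  define Y where "Y = matrix_inv A ** E"
  define lR where "lR = lambda_min R"
  define lP where "lP = lambda_min P"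
  define LP where "LP = lambda_max P"
  \<comment> \<open>The gap between growth under attack and nominal decay: with this timer weight
    both modes reach exactly the net rate \<open>- \<rho>\<close>.\<close>
  define c where "c = lR / LP + eig_a"
  have Rsym: "transpose R = R" and Psym: "transpose P = P" using RP by (simp_all add: pos_def_def)
  have lR: "0 < lR" and lP: "0 < lP" using lambda_min_pos RP by (simp_all add: lR_def lP_def)
  have lPLP: "lP \<le> LP" unfolding lP_def LP_def by (rule lambda_min_le_max[OF Psym])
  with lP have LP: "0 < LP" by simp
  have P_lower: "lP * (norm z)\<^sup>2 \<le> z \<bullet> (P *v z)" and P_upper: "z \<bullet> (P *v z) \<le> LP * (norm z)\<^sup>2" for z
    unfolding lP_def LP_def by (rule lambda_min_lower[OF Psym] lambda_max_upper[OF Psym])+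
  have P_psd: "0 \<le> z \<bullet> (P *v z)" for z using order_trans[OF _ P_lower[of z]] lP by simp
  have A_inv: "A ** matrix_inv A = mat 1"
    by (rule matrix_inv_right) (rule lyapunov_equation_kernel[OF RP(1) RP(3)])
  have nominal_eq: "A\<sigma> s = A" "B\<sigma> s = B" "E\<sigma> s = E"
    by (simp_all add: A\<sigma>_eq B\<sigma>_eq E\<sigma>_eq A_eq nominal)

  have equilibrium: "A\<sigma> i *v (- (X *v u) - Y *v w) + B\<sigma> i *v u + E\<sigma> i *v w = 0"
    if i: "i \<in> insert s Sva" and w: "w \<in> W" for i u w
  proof -
    \<comment> \<open>One point is an equilibrium in all modes; in the nominal mode, where
      \<open>A\<close> is injective, it can only be \<open>x0\<close>.\<close>
    obtain x where x: "\<And>j. j \<in> insert s Sva \<Longrightarrow> 0 = A\<sigma> j *v x + B\<sigma> j *v u + E\<sigma> j *v w"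
      using A7 w by blast
    define x0 where "x0 = - (X *v u) - Y *v w"
    have "A *v x + B *v u + E *v w = 0" using x[of s] by (simp add: nominal_eq)
    moreover have "A *v x0 + B *v u + E *v w = 0"
    proof -
      have "A *v (X *v u) = B *v u" "A *v (Y *v w) = E *v w"
        by (simp_all add: X_def Y_def matrix_vector_mul_assoc matrix_mul_assoc A_inv)
      moreover have "A *v x0 = - (A *v (X *v u)) - A *v (Y *v w)"
        unfolding x0_def by (metis (no_types) diff_0 matrix_vector_mult_0_right matrix_vector_mult_diff_distrib)
      ultimately show ?thesis by simp
    qed
    ultimately have "A *v x = A *v x0"
      by (metis (no_types) add_right_cancel)
    then have "A *v (x - x0) = 0" by (simp add: matrix_vector_mult_diff_distrib)
    then have "x = x0" using lyapunov_equation_kernel[OF RP(1) RP(3), of "x - x0"] by simp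
    then show ?thesis using x[OF i] by (simp add: x0_def)
  qed

  \<comment> \<open>The cost, its gradient and its minimizer\<close>
  define g where "g w u = gradient fu u + transpose G *v gradient fy (G *v u + H *v w)" for w u
  define q where "q w u = f u w - f (ustar w) w" for w u
  have grad_f: "GDERIV (\<lambda>u. f u w) u :> g w u" for u w
    unfolding f_eq g_def by (intro GDERIV_add_affine_compose cont_differentiable_GDERIV A3)
  have grad: "GDERIV (q w) u :> g w u" for u w
    using GDERIV_diff[OF grad_f GDERIV_const] by (simp add: q_def[abs_def])
  have "l-lipschitz_on UNIV (g w)" for w
  proof (rule lipschitz_onI)
    fix u u' :: "real^'m"
    have "norm (transpose G *v gradient fy (G *v u + H *v w) - transpose G *v gradient fy (G *v u' + H *v w))
        \<le> spectral_norm G * (ly * norm ((G *v u + H *v w) - (G *v u' + H *v w)))"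
      by (rule norm_transpose_mult_lipschitz[OF A3(6)])
    also have "\<dots> = spectral_norm G * (ly * norm (G *v (u - u')))"
      by (simp add: matrix_vector_mult_diff_distrib)
    also have "\<dots> \<le> spectral_norm G * (ly * (spectral_norm G * norm (u - u')))"
      using A3(4) by (intro mult_left_mono norm_mult_le_spectral_norm spectral_norm_nonneg) auto
    finally have "norm (g w u - g w u') \<le> lu * norm (u - u')
        + spectral_norm G * (ly * (spectral_norm G * norm (u - u')))"
      using lipschitz_onD[OF A3(5), of u u']
      unfolding g_def dist_norm add_diff_add by (intro norm_triangle_le add_mono) auto
    then show "dist (g w u) (g w u') \<le> l * dist u u'"
      by (simp add: dist_norm l_eq power2_eq_square algebra_simps)
  next
    show "0 \<le> l" using A3(3,4) by (simp add: l_eq)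
  qed
  note g_lip = this
  have ustar_min: "is_arg_min (\<lambda>u. f u w) (\<lambda>_. True) (ustar w)" for w
    unfolding ustar_eq using A4(1) by (metis (mono_tags, lifting) theI')
  have least: "f (ustar w) w \<le> f u w" for u w
    using ustar_min[of w] by (simp add: is_arg_min_linorder)
  have unique: "u = ustar w" if "f u w = f (ustar w) w" for u w
  proof -
    have "is_arg_min (\<lambda>u. f u w) (\<lambda>_. True) u"
      using least[of w] that by (simp add: is_arg_min_linorder)
    then show ?thesis using A4(1) ustar_min by blast
  qed
  have PL: "\<mu> * (f u w - f (ustar w) w) \<le> (norm (g w u))\<^sup>2 / 2" if "w \<in> W" for u w
    using bspec[OF spec[OF A4(3), of u] that] by (simp add: gradient_eq[OF grad_f])
  have \<mu>l: "\<mu> \<le> l"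
  proof -
    obtain w where w: "w \<in> W" using False by blast
    show ?thesis
      by (rule PL_constant_le_lipschitz[where f = "\<lambda>u. f u w" and g = "g w" and a = "ustar w"])
         (fact grad_f g_lip least unique A4(2) PL[OF w])+
  qed
  have g_ustar: "g w (ustar w) = 0" for w by (rule GDERIV_minimum[OF grad_f least])
  \<comment> \<open>\<open>g w\<close> vanishes at \<open>ustar w\<close>, so \<open>g w'\<close> is
    there at most \<open>\<mu> * Lu * norm (w - w')\<close>; growth of \<open>g w'\<close> away from
    \<open>ustar w'\<close> divides this by \<open>\<mu>\<close>.\<close>
  define Lu where "Lu = spectral_norm G * (ly * spectral_norm H) / \<mu>"
  have ustar_lip: "Lu-lipschitz_on W ustar"
  proof (rule lipschitz_onI)
    fix w w' assume w: "w \<in> W" "w' \<in> W"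
    have "\<mu> * norm (ustar w - ustar w') \<le> norm (g w' (ustar w))"
      by (rule PL_gradient_growth[where f = "\<lambda>u. f u w'"])
         (fact grad_f least unique A4(2) PL[OF w(2)])+
    also have "\<dots> = norm (g w (ustar w) - g w' (ustar w))" by (simp add: g_ustar)
    also have "\<dots> \<le> spectral_norm G
        * (ly * norm ((G *v ustar w + H *v w) - (G *v ustar w + H *v w')))"
      using norm_transpose_mult_lipschitz[OF A3(6), of G "G *v ustar w + H *v w" "G *v ustar w + H *v w'"]
      by (simp add: g_def)
    also have "\<dots> = spectral_norm G * (ly * norm (H *v (w - w')))"
      by (simp add: matrix_vector_mult_diff_distrib)
    also have "\<dots> \<le> spectral_norm G * (ly * (spectral_norm H * norm (w - w')))"
      using A3(4) by (intro mult_left_mono norm_mult_le_spectral_norm spectral_norm_nonneg) auto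
    finally show "dist (ustar w) (ustar w') \<le> Lu * dist w w'"
      using A4(2) by (simp add: Lu_def dist_norm field_simps)
  next
    show "0 \<le> Lu"
      using A3(4) A4(2) by (simp add: Lu_def spectral_norm_nonneg)
  qed

  \<comment> \<open>Since \<open>lP \<le> LP\<close>, the number \<open>\<beta>\<close> cannot be
    both above \<open>LP\<close> and below \<open>lP\<close>.\<close>
  have \<omega>1: "1 \<le> \<omega>"
  proof (cases "\<beta> \<le> LP")
    case True
    then have "1 \<le> LP / \<beta>" using \<beta>_pos by simp
    then show ?thesis by (simp add: \<omega>_eq LP_def max_def)
  next
    case False
    then have "1 \<le> \<beta> / lP" using lP lPLP by simp
    then show ?thesis by (simp add: \<omega>_eq lP_def max_def)
  qed
  have rate_attack: "lambda_max (transpose (A\<sigma> i) + A\<sigma> i) \<le> eig_a" if "i \<in> Sva" for i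
    unfolding eig_a_eq using that A6(1) by (intro Max_ge) auto
  have eig_a: "0 \<le> eig_a"
  proof -
    obtain i where i: "i \<in> Sva" using mode_indices by blast
    then obtain z where "z \<in> eigenvalues (complex_matrix (A\<sigma> i))" "0 < Re z" using A6(3) by blast
    then show ?thesis using Re_eigenvalue_le_lambda_max[of z "A\<sigma> i"] rate_attack[OF i] by simp
  qed
  have c: "0 \<le> c" using lR LP eig_a by (simp add: c_def)
  have \<rho>: "\<rho> = lR / LP - \<kappa>2 * c - ln \<omega> * \<kappa>1" by (simp add: \<rho>_eq c_def lR_def LP_def)
  have \<rho>_pos: "0 < \<rho>"
  proof -
    have "LP * \<rho> = lR - \<kappa>2 * (lR + LP * eig_a) - LP * ln \<omega> * \<kappa>1"
      using LP by (simp add: \<rho> c_def field_simps)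
    also have "\<dots> > 0" using gain by (simp add: lR_def LP_def)
    finally show ?thesis using LP by (simp add: zero_less_mult_iff)
  qed

  \<comment> \<open>\<open>k0\<close> bounds the gradient error caused by measuring
    \<open>C *v x\<close> instead of the steady-state output, \<open>b0\<close> the effect of the
    drift \<open>X *v u'\<close>, with \<open>u'\<close> the velocity of \<open>u\<close>, on the
    quadratic form.\<close>
  define k0 where "k0 = ly * spectral_norm C * spectral_norm G"
  define m where "m = min lP \<beta>"
  define Mm where "Mm = max LP \<beta>"
  define b0 where "b0 = Mm * spectral_norm X"
  have m: "0 < m" and Mm: "0 < Mm" using lP LP \<beta>_pos by (simp_all add: m_def Mm_def)
  have k0: "0 \<le> k0" using A3(4) by (simp add: k0_def spectral_norm_nonneg)
  have b0: "0 \<le> b0" using Mm by (simp add: b0_def spectral_norm_nonneg)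
  have "\<epsilon> * (2 * exp \<tau>0 * k0 * b0 * (\<mu>\<^sup>2 + l\<^sup>2)) < \<rho> * m * \<mu>\<^sup>2"
  proof (rule ereal_less_divide_imp_mult_less)
    have "2 * exp \<tau>0 * k0 * b0 * (\<mu>\<^sup>2 + l\<^sup>2) = 2 * ly * exp \<tau>0 * spectral_norm C * spectral_norm G
        * spectral_norm (matrix_inv A ** B) * max (lambda_max P) \<beta> * (\<mu>\<^sup>2 + l\<^sup>2)"
      by (simp add: k0_def b0_def X_def Mm_def LP_def)
    then show "ereal \<epsilon> < ereal (\<rho> * m * \<mu>\<^sup>2) / ereal (2 * exp \<tau>0 * k0 * b0 * (\<mu>\<^sup>2 + l\<^sup>2))"
      using \<epsilon>_bounds(2) by (simp only: m_def lP_def)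
    show "0 < \<rho> * m * \<mu>\<^sup>2" using \<rho>_pos m A4(2) by simp
    show "0 \<le> 2 * exp \<tau>0 * k0 * b0 * (\<mu>\<^sup>2 + l\<^sup>2)" using k0 b0 by simp
  qed
  \<comment> \<open>Here \<open>\<mu> \<le> l\<close> enters; afterwards
    \<open>\<mu>\<^sup>2\<close> cancels on both sides.\<close>
  moreover have "\<epsilon> * (2 * exp \<tau>0 * k0 * b0 * (\<mu>\<^sup>2 + \<mu>\<^sup>2)) \<le> \<epsilon> * (2 * exp \<tau>0 * k0 * b0 * (\<mu>\<^sup>2 + l\<^sup>2))"
    using \<mu>l A4(2) \<epsilon>_bounds(1) k0 b0 by (intro mult_left_mono add_left_mono power_mono) auto
  ultimately have "(4 * exp \<tau>0 * \<epsilon> * k0 * b0) * \<mu>\<^sup>2 < (\<rho> * m) * \<mu>\<^sup>2"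
    by (simp add: algebra_simps)
  then have "(4 * exp \<tau>0 * \<epsilon>) * k0 * b0 < \<rho> * m"
    using A4(2) by simp
  from perturb_to_positive[OF k0 b0 this] obtain k b
    where kb: "k0 \<le> k" "b0 \<le> b" "0 < k" "0 < b" "4 * exp \<tau>0 * \<epsilon> * k * b < \<rho> * m"
    by metis
  have \<tau>0_eq': "\<tau>0 = ln \<omega> * real N0 + c * T0" by (simp add: \<tau>0_eq c_def lR_def LP_def)
  have ln\<omega>: "0 \<le> ln \<omega>" using \<omega>1 by simp
  have "1 \<le> exp \<tau>0"
    unfolding \<tau>0_eq' using ln\<omega> c timer_params by simp
  from interconnection_decay[OF kb(3,4) this \<epsilon>_bounds(1) m A4(2) kb(5)]
  obtain \<delta> where \<delta>: "0 < \<delta>"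
    "\<And>t \<zeta> y S r. \<lbrakk>1 \<le> t; t \<le> exp \<tau>0; 0 \<le> \<zeta>; 0 \<le> y; m * \<zeta>\<^sup>2 \<le> S; r \<le> y\<^sup>2 / (2 * \<mu>)\<rbrakk> \<Longrightarrow>
      k / (2 * b) * t * (- \<rho> * S + 2 * b * \<epsilon> * \<zeta> * (y + k * \<zeta>)) - \<epsilon> * y\<^sup>2 + \<epsilon> * k * \<zeta> * y
        \<le> - \<delta> * (k / (2 * b) * t * S + r)"
    by blast

  \<comment> \<open>The mode-dependent quadratic form\<close>
  define Q where "Q i = (if i = s then P else \<beta> *\<^sub>R mat 1)" for i
  define rate where "rate i = (if i = s then - (lR / LP) else eig_a)" for i
  have Q_s: "Q s = P" by (simp add: Q_def)
  have Q_a: "Q i *v z = \<beta> *\<^sub>R z" if "i \<noteq> s" for i z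
    using that by (simp add: Q_def flip: scaleR_matrix_vector_assoc)
  have Q_form_a: "z \<bullet> (Q i *v z) = \<beta> * (norm z)\<^sup>2" if "i \<noteq> s" for i z
    using Q_a[OF that] by (simp add: power2_norm_eq_inner)
  have Q_sym: "transpose (Q i) = Q i" for i
    by (simp add: Q_def Psym transpose_scalar)
  have Q_lower: "m * (norm z)\<^sup>2 \<le> z \<bullet> (Q i *v z)" for i z
  proof (cases "i = s")
    case True
    have "m * (norm z)\<^sup>2 \<le> lP * (norm z)\<^sup>2" by (intro mult_right_mono) (auto simp: m_def)
    then show ?thesis using P_lower[of z] by (simp add: True Q_s)
  qed (auto simp: Q_form_a m_def intro!: mult_right_mono)
  have Q_upper: "z \<bullet> (Q i *v z) \<le> Mm * (norm z)\<^sup>2" for i z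
  proof (cases "i = s")
    case True
    have "LP * (norm z)\<^sup>2 \<le> Mm * (norm z)\<^sup>2" by (intro mult_right_mono) (auto simp: Mm_def)
    then show ?thesis using P_upper[of z] by (simp add: True Q_s)
  qed (auto simp: Q_form_a Mm_def intro!: mult_right_mono)
  have Q_norm: "norm (Q i *v z) \<le> Mm * norm z" for i z
    by (rule psd_norm_mult_le[OF Q_sym order_trans[OF _ Q_lower] Q_upper]) (use m in simp)
  have Q_coupling: "(Q i *v z) \<bullet> (X *v v) \<le> b * norm z * norm v" for i z v
  proof -
    have "(Q i *v z) \<bullet> (X *v v) \<le> (Mm * norm z) * (spectral_norm X * norm v)"
      by (rule order_trans[OF norm_cauchy_schwarz mult_mono[OF Q_norm norm_mult_le_spectral_norm]])
         (use Mm in auto)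
    also have "\<dots> = b0 * norm z * norm v" by (simp add: b0_def)
    also have "\<dots> \<le> b * norm z * norm v" using kb(2) by (intro mult_right_mono) auto
    finally show ?thesis .
  qed
  have Q_rate: "2 * ((Q i *v z) \<bullet> (A\<sigma> i *v z)) \<le> rate i * (z \<bullet> (Q i *v z))"
    if i: "i \<in> insert s Sva" for i z
  proof (cases "i = s")
    case True
    have "(- R) *v z = transpose A *v (P *v z) + P *v (A *v z)"
      unfolding RP(3)[symmetric] by (simp add: matrix_vector_mult_add_rdistrib matrix_vector_mul_assoc)
    then have "z \<bullet> ((- R) *v z) = 2 * ((P *v z) \<bullet> (A *v z))"
      using inner_transpose_mult[of A "P *v z" z] inner_symmetric_mult[OF Psym, of z "A *v z"]
      by (simp add: inner_add_right inner_commute del: transpose_matrix_vector)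
    moreover have "(- R) *v z = - (R *v z)"
      by (rule matrix_vector_mult_minus_left)
    ultimately have "2 * ((P *v z) \<bullet> (A *v z)) = - (z \<bullet> (R *v z))" by simp
    also have "\<dots> \<le> - (lR * (norm z)\<^sup>2)" using lambda_min_lower[OF Rsym, of z] by (simp add: lR_def)
    \<comment> \<open>Decay in the Euclidean norm becomes decay of the form itself by dividing by
      the largest eigenvalue of \<open>P\<close>.\<close>
    also have "\<dots> \<le> - (lR / LP * (z \<bullet> (P *v z)))"
      using mult_left_mono[OF P_upper[of z], of "lR / LP"] lR LP by simp
    finally show ?thesis by (simp add: True Q_s rate_def nominal_eq)
  next
    case False
    then have "i \<in> Sva" using i by simp
    have sym: "transpose (transpose (A\<sigma> i) + A\<sigma> i) = transpose (A\<sigma> i) + A\<sigma> i"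
      by (auto simp: transpose_def vec_eq_iff)
    have "2 * (z \<bullet> (A\<sigma> i *v z)) = z \<bullet> ((transpose (A\<sigma> i) + A\<sigma> i) *v z)"
      using inner_transpose_mult[of "A\<sigma> i" z z]
      by (simp only: matrix_vector_mult_add_rdistrib inner_add_right inner_commute)
    also have "\<dots> \<le> eig_a * (norm z)\<^sup>2"
      using lambda_max_upper[OF sym, of z] mult_right_mono[OF rate_attack[OF \<open>i \<in> Sva\<close>], of "(norm z)\<^sup>2"]
      by simp
    finally have "\<beta> * (2 * (z \<bullet> (A\<sigma> i *v z))) \<le> \<beta> * (eig_a * (norm z)\<^sup>2)"
      using \<beta>_pos by (intro mult_left_mono) auto
    then show ?thesis using False by (simp add: Q_a Q_form_a rate_def mult_ac power2_norm_eq_inner)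
  qed
  \<comment> \<open>All attack modes share one matrix, so only switches into or out of the nominal
    mode matter; their ratios are the two entries of the maximum \<open>\<omega>\<close>.\<close>
  have Q_jump: "z \<bullet> (Q j *v z) \<le> exp (ln \<omega>) * (z \<bullet> (Q i *v z))" for i j z
  proof -
    have f0: "0 \<le> z \<bullet> (Q i *v z)" using order_trans[OF _ Q_lower[of z i]] m by simp
    consider "(i = s) = (j = s)" | "i = s" "j \<noteq> s" | "i \<noteq> s" "j = s" by blast
    then have "z \<bullet> (Q j *v z) \<le> \<omega> * (z \<bullet> (Q i *v z))"
    proof cases
      case 1
      then have "Q j = Q i" by (simp add: Q_def)
      then show ?thesis using mult_right_mono[OF \<omega>1 f0] by simp
    next
      case 2
      have "\<beta> * (norm z)\<^sup>2 = \<beta> / lP * (lP * (norm z)\<^sup>2)" using lP by simp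
      also have "\<dots> \<le> \<omega> * (z \<bullet> (P *v z))"
        using \<omega>1 lP by (intro mult_mono P_lower) (simp_all add: \<omega>_eq lP_def)
      finally show ?thesis using 2 by (simp add: Q_form_a Q_s)
    next
      case 3
      have "z \<bullet> (P *v z) \<le> LP / \<beta> * (\<beta> * (norm z)\<^sup>2)" using \<beta>_pos P_upper by simp
      also have "\<dots> \<le> \<omega> * (\<beta> * (norm z)\<^sup>2)"
        using \<beta>_pos by (intro mult_right_mono) (auto simp: \<omega>_eq LP_def)
      finally show ?thesis using 3 by (simp add: Q_form_a Q_s)
    qed
    then show ?thesis using \<omega>1 by simp
  qed

  interpret attacked_interconnection A\<sigma> B\<sigma> E\<sigma> C G fu fy s Sva W N0 T0 \<kappa>1 \<kappa>2 \<epsilon> X Y Q q g ustar rate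
    k b m Mm \<mu> l Lu "ln \<omega>" c \<rho> \<delta> "exp \<tau>0"
  proof
    show "compact W" "W \<noteq> {}" "finite Sva" "0 \<le> T0" "0 \<le> \<kappa>1" "0 < \<epsilon>" "0 \<le> ln \<omega>" "0 \<le> c"
      "0 < k" "0 < b" "0 < m" "0 < Mm" "0 < \<mu>" "0 < \<delta>"
      using A1(2) False A6(1) timer_params \<epsilon>_bounds(1) ln\<omega> c kb m Mm A4(2) \<delta>(1) by auto
    show "norm (gradient fu u + transpose G *v gradient fy (C *v x) - g w u)
        \<le> k * norm (x + X *v u + Y *v w)" for x u w
    proof -
      \<comment> \<open>\<open>G *v u + H *v w\<close> is the output at the quasi-steady state, so
        the output error is \<open>C\<close> applied to the deviation.\<close>
      have "G *v u = - (C *v (X *v u))" "H *v w = - (C *v (Y *v w))"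
        by (simp_all add: G_eq H_eq X_def Y_def matrix_vector_mult_minus_left
            matrix_vector_mul_assoc matrix_mul_assoc)
      then have Cz: "C *v x - (G *v u + H *v w) = C *v (x + X *v u + Y *v w)"
        by (simp add: matrix_vector_right_distrib)
      have "norm (gradient fu u + transpose G *v gradient fy (C *v x) - g w u)
          \<le> spectral_norm G * (ly * norm (C *v x - (G *v u + H *v w)))"
        using norm_transpose_mult_lipschitz[OF A3(6), of G "C *v x" "G *v u + H *v w"]
        by (simp add: g_def)
      also have "\<dots> \<le> spectral_norm G * (ly * (spectral_norm C * norm (x + X *v u + Y *v w)))"
        unfolding Cz using A3(4)
        by (intro mult_left_mono norm_mult_le_spectral_norm spectral_norm_nonneg) auto
      also have "\<dots> = k0 * norm (x + X *v u + Y *v w)" by (simp add: k0_def)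
      also have "\<dots> \<le> k * norm (x + X *v u + Y *v w)" using kb(1) by (intro mult_right_mono) auto
      finally show ?thesis .
    qed
    show "continuous_on UNIV (g w)" for w by (rule lipschitz_on_continuous_on[OF g_lip])
    show "q w u \<le> (norm (g w u))\<^sup>2 / (2 * \<mu>)" if "w \<in> W" for w u
      using PL[OF that, of u] A4(2) by (simp add: q_def field_simps)
    show "\<mu> / 2 * (norm (u - ustar w))\<^sup>2 \<le> q w u" if "w \<in> W" for w u
      unfolding q_def
      by (rule quadratic_growth[where f = "\<lambda>u. f u w"]) (fact grad_f least unique A4(2) PL[OF that])+
    show "norm (g w u) \<le> l * norm (u - ustar w)" for w u
      using lipschitz_onD[OF g_lip[of w], of u "ustar w"] by (simp add: dist_norm g_ustar)
    show "ln \<omega> * \<kappa>1 + c * (\<kappa>2 - indicator Sva i) + rate i \<le> - \<rho>" if "i \<in> insert s Sva" for i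
    proof (cases "i = s")
      case True
      then show ?thesis using mode_indices(3) by (simp add: rate_def \<rho> mult.commute)
    next
      case False
      then have "i \<in> Sva" using that by simp
      moreover have "c * (\<kappa>2 - 1) = \<kappa>2 * c - (lR / LP + eig_a)"
        by (simp add: right_diff_distrib mult.commute flip: c_def)
      ultimately show ?thesis using False by (simp add: rate_def \<rho> mult.commute)
    qed
    show "exp (ln \<omega> * real N0 + c * T0) \<le> exp \<tau>0" by (simp add: \<tau>0_eq')
  qed (fact equilibrium grad ustar_lip Q_sym Q_lower Q_upper Q_coupling Q_rate Q_jump \<delta>(2))+

  show ?thesis
    using UGES_attractor unfolding attractor_def by (simp only: xstar_eq X_def Y_def)
qed

end
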